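(* Let $p$ be a prime, let $n$ be a positive integer, let $A=C_{p^n}\times C_p$, and let $G$ be a finite metacyclic group. Suppose that $C(G)=C(A)$. Then $G$ is abelian and $G\cong A$.
   Context: All groups are finite. $C_m$ denotes the cyclic group of order $m$. A group is metacyclic if it has a cyclic normal subgroup with cyclic quotient. ${\rm Irr}(G)$ denotes the set of complex irreducible characters of $G$. For $\chi\in{\rm Irr}(G)$ the codegree of $\chi$ is ${\rm cod}\,\chi=\frac{|G:\ker\chi|}{\chi(1)}$, and ${\rm Cod}(G)=\{{\rm cod}\,\chi\mid\chi\in{\rm Irr}(G)\}$. The group pseudo-algebra of $G$ is $C(G)=\{(d,m_G(d))\mid d\in{\rm Cod}(G)\}$, where $m_G(d)$ is the number of irreducible characters of $G$ with codegree $d$. *)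

theory Defs
  imports
    Complex_Main
    "HOL-Computational_Algebra.Primes"
    "HOL-Algebra.Elementary_Groups"
    "Jordan_Normal_Form.VS_Connect"
begin

definition metacyclic :: "('a, 'b) monoid_scheme \<Rightarrow> bool" where
  "metacyclic G \<longleftrightarrow>
    (\<exists>N. N \<lhd> G \<and> cyclic_group (G\<lparr>carrier := N\<rparr>) \<and> cyclic_group (G Mod N))"

definition mat_trace :: "'a::comm_monoid_add mat \<Rightarrow> 'a" where
  "mat_trace A = (\<Sum>i<dim_row A. A $$ (i, i))"

text \<open>Complex matrix representations of degree \<open>n\<close>: homomorphisms to \<open>GL(n, \<complex>)\<close>,
  the group of units of the ring of complex \<open>n \<times> n\<close> matrices.\<close>

definition representations :: "('a, 'b) monoid_scheme \<Rightarrow> nat \<Rightarrow> ('a \<Rightarrow> complex mat) set" where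
  "representations G n = hom G (units_of (ring_mat TYPE(complex) n ()))"

definition irreducible_representation ::
    "('a, 'b) monoid_scheme \<Rightarrow> nat \<Rightarrow> ('a \<Rightarrow> complex mat) \<Rightarrow> bool" where
  "irreducible_representation G n \<rho> \<longleftrightarrow>
    \<rho> \<in> representations G n \<and> n > 0 \<and>
    (\<forall>W. VectorSpace.subspace class_ring W (module_vec TYPE(complex) n) \<longrightarrow>
         (\<forall>g \<in> carrier G. \<forall>w \<in> W. \<rho> g *\<^sub>v w \<in> W) \<longrightarrow>
         W = {0\<^sub>v n} \<or> W = carrier_vec n)"

text \<open>The restriction to \<open>carrier G\<close> makes characters that agree on the group equal as
  HOL functions, so that irreducible characters can be counted.\<close>

definition character_of :: "('a, 'b) monoid_scheme \<Rightarrow> ('a \<Rightarrow> complex mat) \<Rightarrow> 'a \<Rightarrow> complex" where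
  "character_of G \<rho> = restrict (\<lambda>g. mat_trace (\<rho> g)) (carrier G)"

definition Irr :: "('a, 'b) monoid_scheme \<Rightarrow> ('a \<Rightarrow> complex) set" where
  "Irr G = {character_of G \<rho> | n \<rho>. irreducible_representation G n \<rho>}"

definition character_kernel :: "('a, 'b) monoid_scheme \<Rightarrow> ('a \<Rightarrow> complex) \<Rightarrow> 'a set" where
  "character_kernel G \<chi> = {g \<in> carrier G. \<chi> g = \<chi> \<one>\<^bsub>G\<^esub>}"

text \<open>The value \<open>\<chi> \<one>\<close> is a complex number (equal to the degree), so codegrees are too.\<close>

definition codegree :: "('a, 'b) monoid_scheme \<Rightarrow> ('a \<Rightarrow> complex) \<Rightarrow> complex" where
  "codegree G \<chi> = of_nat (card (rcosets\<^bsub>G\<^esub> (character_kernel G \<chi>))) / \<chi> \<one>\<^bsub>G\<^esub>"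

definition Cod :: "('a, 'b) monoid_scheme \<Rightarrow> complex set" where
  "Cod G = {codegree G \<chi> | \<chi>. \<chi> \<in> Irr G}"

definition codegree_mult :: "('a, 'b) monoid_scheme \<Rightarrow> complex \<Rightarrow> nat" where
  "codegree_mult G d = card {\<chi> \<in> Irr G. codegree G \<chi> = d}"

definition group_pseudo_algebra :: "('a, 'b) monoid_scheme \<Rightarrow> (complex \<times> nat) set" where
  "group_pseudo_algebra G = {(d, codegree_mult G d) | d. d \<in> Cod G}"

end

theory Submission
  imports Defs "HOL-Number_Theory.Residues" "HOL-Algebra.Multiplicative_Group"
begin

text \<open>Let \<open>x\<close> generate a cyclic normal subgroup of order \<open>K\<close> and \<open>y\<close> the quotient, of order \<open>M\<close>,
  with \<open>x y = y x\<^sup>r\<close> and \<open>y\<^sup>M = x\<^sup>s\<close>. In an irreducible representation choose a common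
  eigenvector of \<open>x\<close> (eigenvalue \<open>z\<close>) and \<open>y\<^sup>m\<close> (eigenvalue \<open>c\<close>), where \<open>m\<close> is the length of the orbit
  of \<open>z\<close> under \<open>z \<mapsto> z\<^sup>r\<close>. Its translates under \<open>y\<close> form a basis in which \<open>x\<close> is diagonal and \<open>y\<close> a
  weighted \<open>m\<close>-cycle, so the irreducible characters, their degrees and kernels can be read off from
  the pairs \<open>(z, c)\<close>. The abelian group \<open>A\<close> is a special case.

  Characters induced from faithful characters of cyclic sections show that \<open>K\<close> and \<open>M\<close> are powers
  of \<open>p\<close>. If \<open>p\<close> is odd, \<open>r \<equiv> 1\<close> modulo 4, or \<open>K\<close> divides 4, then lifting the exponent bounds the
  orbits from below, and there are fewer nonlinear than linear characters; as both \<open>|Irr(G)| = p\<^sup>n\<^sup>+\<^sup>1\<close> and the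
  number of linear characters are powers of \<open>p\<close>, all characters are linear and \<open>G\<close> is abelian. In the
  remaining case \<open>p = 2\<close>, \<open>r \<equiv> 3\<close> modulo 4 and 8 divides \<open>K\<close>, so that \<open>G\<close> has a dihedral quotient of
  order 8; counting characters of codegree 4 then gives a contradiction. Finally, the codegrees of
  an abelian group detect its exponent, which determines \<open>A\<close> among the abelian groups of
  order \<open>p\<^sup>n\<^sup>+\<^sup>1\<close>.\<close>

section \<open>Invariant subspaces and monomial matrices\<close>

lemma mat_trace_comm:
  fixes A B :: "'a::comm_semiring_0 mat"
  assumes "A \<in> carrier_mat n m" "B \<in> carrier_mat m n"
  shows "mat_trace (A * B) = mat_trace (B * A)"
proof -
  have "mat_trace (A * B) = (\<Sum>i<n. \<Sum>k<m. A $$ (i, k) * B $$ (k, i))"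
    using assms unfolding mat_trace_def by (auto simp: scalar_prod_def atLeast0LessThan)
  also have "\<dots> = (\<Sum>k<m. \<Sum>i<n. B $$ (k, i) * A $$ (i, k))"
    by (subst sum.swap) (simp add: mult.commute)
  also have "\<dots> = mat_trace (B * A)"
    using assms unfolding mat_trace_def by (auto simp: scalar_prod_def atLeast0LessThan)
  finally show ?thesis .
qed

lemma mat_trace_one: "mat_trace (1\<^sub>m n :: 'a::semiring_1 mat) = of_nat n"
  by (simp add: mat_trace_def)

text \<open>\<open>R\<close> inverts \<open>P\<close> on both sides, so cyclicity of the trace
  applies to \<open>A = P B R\<close>. Keeping the sizes \<open>n\<close> and \<open>m\<close> apart
  allows a comparison of two representations before their degrees are known to agree.\<close>

lemma mat_trace_intertwine:
  fixes A B :: "'a::comm_semiring_1 mat"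
  assumes A: "A \<in> carrier_mat n n" and B: "B \<in> carrier_mat m m"
    and P: "P \<in> carrier_mat n m" and R: "R \<in> carrier_mat m n"
    and PR: "P * R = 1\<^sub>m n" and RP: "R * P = 1\<^sub>m m" and AP: "A * P = P * B"
  shows "mat_trace A = mat_trace B"
proof -
  have "mat_trace A = mat_trace ((A * P) * R)"
    using A P R PR by (simp add: assoc_mult_mat[OF A P R])
  also have "\<dots> = mat_trace (R * (A * P))"
    using mat_trace_comm[of "A * P" n m R] A P R by simp
  also have "\<dots> = mat_trace ((R * P) * B)"
    using AP assoc_mult_mat[OF R P B] by simp
  also have "\<dots> = mat_trace B"
    using RP B by simp
  finally show ?thesis .
qed

lemma smult_vec_cancel:
  fixes v :: "'a::idom vec"
  assumes v: "v \<in> carrier_vec n" "v \<noteq> 0\<^sub>v n" and e: "a \<cdot>\<^sub>v v = b \<cdot>\<^sub>v v"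
  shows "a = b"
proof (rule ccontr)
  assume "a \<noteq> b"
  have "v $ l = 0" if "l < n" for l
    using arg_cong[OF e, of "\<lambda>w. w $ l"] that v(1) \<open>a \<noteq> b\<close> by auto
  then have "v = 0\<^sub>v n" using v(1) by (intro eq_vecI) auto
  then show False using v(2) by simp
qed

lemma minus_vec_eq_zeroD:
  fixes v w :: "'a::ab_group_add vec"
  assumes "v \<in> carrier_vec n" "w \<in> carrier_vec n" "v - w = 0\<^sub>v n"
  shows "v = w"
proof (rule eq_vecI)
  fix i assume "i < dim_vec w"
  then show "v $ i = w $ i" using arg_cong[OF assms(3), of "\<lambda>u. u $ i"] assms(1,2) by simp
qed (use assms in simp)

abbreviation vec_subspace :: "nat \<Rightarrow> complex vec set \<Rightarrow> bool" where
  "vec_subspace n W \<equiv> VectorSpace.subspace class_ring W (module_vec TYPE(complex) n)"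

lemma vec_subspace_iff:
  "vec_subspace n W \<longleftrightarrow> W \<subseteq> carrier_vec n \<and> 0\<^sub>v n \<in> W \<and>
     (\<forall>v\<in>W. \<forall>w\<in>W. v + w \<in> W) \<and> (\<forall>a. \<forall>v\<in>W. a \<cdot>\<^sub>v v \<in> W)"
  using vec_vs[where 'a=complex and n=n] vec_module[where 'a=complex and n=n]
  unfolding VectorSpace.subspace_def LinearCombinations.submodule_def module_vec_simps
  by (auto simp: class_ring_simps module_vec_simps)

text \<open>The combination is spelled out entrywise to match the vectors built by
  averaging.\<close>

lemma vec_subspace_sum:
  fixes q :: nat
  assumes W: "vec_subspace n W" and f: "\<And>i. i < q \<Longrightarrow> f i \<in> W"
  shows "vec n (\<lambda>l. \<Sum>i<q. a i * f i $ l) \<in> W"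
  using f
proof (induction q)
  case 0
  have "vec n (\<lambda>l. \<Sum>i<0. a i * f i $ l) = 0\<^sub>v n" by auto
  then show ?case using W by (simp add: vec_subspace_iff)
next
  case (Suc q)
  have "f q \<in> carrier_vec n" using Suc.prems[of q] W by (auto simp: vec_subspace_iff)
  then have "vec n (\<lambda>l. \<Sum>i<Suc q. a i * f i $ l) = vec n (\<lambda>l. \<Sum>i<q. a i * f i $ l) + a q \<cdot>\<^sub>v f q"
    by (intro eq_vecI) auto
  moreover have "vec n (\<lambda>l. \<Sum>i<q. a i * f i $ l) \<in> W" using Suc by simp
  moreover have "a q \<cdot>\<^sub>v f q \<in> W" using Suc.prems[of q] W by (simp add: vec_subspace_iff)
  ultimately show ?case using W by (simp add: vec_subspace_iff)
qed

lemma vec_subspace_eigenspace: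
  assumes X: "X \<in> carrier_mat n n"
  shows "vec_subspace n {v \<in> carrier_vec n. X *\<^sub>v v = z \<cdot>\<^sub>v v}"
  using X unfolding vec_subspace_iff
  by (auto simp: mult_add_distrib_mat_vec[of X n n] smult_add_distrib_vec[of _ n]
      mult_mat_vec[of X n n] smult_smult_assoc mult.commute)

section \<open>Averaging over roots of unity\<close>

lemma exists_primitive_root:
  assumes "Q > 0"
  shows "\<exists>w::complex. \<forall>k. w ^ k = 1 \<longleftrightarrow> Q dvd k"
proof -
  define w where "w = cis (2 * pi / real Q)"
  have wQ: "w ^ Q = 1" using assms by (simp add: w_def DeMoivre)
  have inj: "inj_on (\<lambda>k. cis (2 * pi * real k / real Q)) {..<Q}"
    using bij_betw_roots_unity[OF assms] by (simp add: bij_betw_def)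
  have "w ^ k = 1 \<longleftrightarrow> Q dvd k" for k
  proof -
    have "w ^ k = w ^ (k mod Q + Q * (k div Q))" by simp
    also have "\<dots> = w ^ (k mod Q)" by (simp only: power_add power_mult wQ) simp
    finally have e: "w ^ k = w ^ (k mod Q)" .
    have "w ^ (k mod Q) = cis (2 * pi * real (k mod Q) / real Q)"
      by (simp add: w_def DeMoivre mult.commute)
    moreover have "k mod Q < Q" using assms by simp
    ultimately have "w ^ (k mod Q) = 1 \<longleftrightarrow> k mod Q = 0"
      using inj_onD[OF inj, of "k mod Q" 0] assms by auto
    then show ?thesis using e by (simp add: dvd_eq_mod_eq_0)
  qed
  then show ?thesis by blast
qed

text \<open>Multiplication by a primitive root \<open>w\<close> permutes the \<open>Q\<close>-th
  roots of unity, so the sum is unchanged by the factor \<open>w ^ k\<close>, which differs from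
  1.\<close>

lemma sum_power_roots_unity:
  assumes "0 < k" "k < Q"
  shows "(\<Sum>c | c ^ Q = 1. c ^ k) = (0::complex)"
proof -
  obtain w :: complex where w: "\<And>k. w ^ k = 1 \<longleftrightarrow> Q dvd k"
    using exists_primitive_root[of Q] assms by auto
  have wQ: "w ^ Q = 1" by (simp add: w)
  have w0: "w \<noteq> 0" using wQ assms by (metis zero_neq_one power_0_left not_less_zero)
  have "bij_betw ((*) w) {c. c ^ Q = 1} {c. c ^ Q = 1}"
    by (rule bij_betwI[where g = "\<lambda>c. c / w"]) (auto simp: power_mult_distrib power_divide wQ w0)
  from sum.reindex_bij_betw[OF this, of "\<lambda>c. c ^ k"]
  have "w ^ k * (\<Sum>c | c ^ Q = 1. c ^ k) = (\<Sum>c | c ^ Q = 1. c ^ k)"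
    by (simp add: power_mult_distrib sum_distrib_left)
  moreover have "w ^ k \<noteq> 1" using w assms by (simp add: nat_dvd_not_less)
  ultimately show ?thesis by simp
qed

text \<open>A discrete Fourier transform of the periodic sequence \<open>u\<close>: for each
  \<open>Q\<close>-th root of unity \<open>c\<close> the sum with weights \<open>c ^ (Q - k)\<close>
  is zero or an eigenvector for \<open>c\<close>, and adding these sums over all \<open>c\<close>
  gives \<open>Q\<close> times \<open>u 0\<close>. The eigenvector is an explicit combination of the
  \<open>u k\<close>, so it stays in any subspace containing them.\<close>

lemma exists_eigenvector_averaging:
  fixes B :: "complex mat" and u :: "nat \<Rightarrow> complex vec"
  assumes B: "B \<in> carrier_mat n n" and Q: "Q > 0"
    and u: "\<And>k. u k \<in> carrier_vec n" and u_Suc: "\<And>k. u (Suc k) = B *\<^sub>v u k"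
    and uQ: "u Q = u 0" and u0: "u 0 \<noteq> 0\<^sub>v n"
  shows "\<exists>c a. vec n (\<lambda>l. \<Sum>k<Q. a k * u k $ l) \<noteq> 0\<^sub>v n \<and>
    B *\<^sub>v vec n (\<lambda>l. \<Sum>k<Q. a k * u k $ l) = c \<cdot>\<^sub>v vec n (\<lambda>l. \<Sum>k<Q. a k * u k $ l)"
proof -
  define w where "w c = vec n (\<lambda>l. \<Sum>k<Q. c ^ (Q - k) * u k $ l)" for c :: complex
  have eig: "B *\<^sub>v w c = c \<cdot>\<^sub>v w c" if c: "c ^ Q = 1" for c
  proof (rule eq_vecI)
    fix l assume "l < dim_vec (c \<cdot>\<^sub>v w c)"
    then have l: "l < n" by (simp add: w_def)
    have "(B *\<^sub>v w c) $ l = (\<Sum>j<n. B $$ (l, j) * (\<Sum>k<Q. c ^ (Q - k) * u k $ j))"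
      using l B by (auto simp: w_def scalar_prod_def atLeast0LessThan)
    also have "\<dots> = (\<Sum>k<Q. c ^ (Q - k) * (\<Sum>j<n. B $$ (l, j) * u k $ j))"
      unfolding sum_distrib_left by (subst sum.swap) (simp add: mult_ac)
    also have "\<dots> = (\<Sum>k<Q. c ^ (Q - k) * u (Suc k) $ l)"
    proof (rule sum.cong[OF refl])
      fix k assume "k \<in> {..<Q}"
      have "(\<Sum>j<n. B $$ (l, j) * u k $ j) = (B *\<^sub>v u k) $ l"
        using l B u[of k] by (auto simp: scalar_prod_def atLeast0LessThan)
      then show "c ^ (Q - k) * (\<Sum>j<n. B $$ (l, j) * u k $ j) = c ^ (Q - k) * u (Suc k) $ l"
        by (simp add: u_Suc)
    qed
    also have "\<dots> = c * (\<Sum>k<Q. c ^ (Q - Suc k) * u (Suc k) $ l)"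
      unfolding sum_distrib_left
      by (intro sum.cong refl) (simp add: Suc_diff_Suc flip: power_Suc mult.assoc)
    also have "(\<Sum>k<Q. c ^ (Q - Suc k) * u (Suc k) $ l) = (\<Sum>k<Q. c ^ (Q - k) * u k $ l)"
    proof -
      \<comment> \<open>The two end terms of the shifted sum agree because \<open>c ^ Q = 1\<close>
        and \<open>u Q = u 0\<close>.\<close>
      have "(\<Sum>k<Suc Q. c ^ (Q - k) * u k $ l) = c ^ Q * u 0 $ l + (\<Sum>k<Q. c ^ (Q - Suc k) * u (Suc k) $ l)"
        by (subst sum.lessThan_Suc_shift) simp
      moreover have "(\<Sum>k<Suc Q. c ^ (Q - k) * u k $ l) = (\<Sum>k<Q. c ^ (Q - k) * u k $ l) + u 0 $ l"
        using uQ by simp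
      ultimately show ?thesis using c by simp
    qed
    finally show "(B *\<^sub>v w c) $ l = (c \<cdot>\<^sub>v w c) $ l"
      using l by (simp add: w_def)
  qed (use B in \<open>simp add: w_def\<close>)
  have "\<exists>c. c ^ Q = 1 \<and> w c \<noteq> 0\<^sub>v n"
  proof (rule ccontr)
    assume "\<not> ?thesis"
    then have z: "w c = 0\<^sub>v n" if "c ^ Q = 1" for c using that by blast
    have "u 0 $ l = 0" if l: "l < n" for l
    proof -
      have "0 = (\<Sum>c | c ^ Q = 1. w c $ l)" using l z by simp
      also have "\<dots> = (\<Sum>k<Q. (\<Sum>c | c ^ Q = 1. c ^ (Q - k)) * u k $ l)"
        using l unfolding w_def by (simp add: sum_distrib_right) (rule sum.swap)
      also have "\<dots> = (\<Sum>k<Q. if k = 0 then of_nat Q * u 0 $ l else 0)"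
        using Q by (intro sum.cong refl) (auto simp: sum_power_roots_unity card_roots_unity_eq)
      also have "\<dots> = of_nat Q * u 0 $ l" using Q by simp
      finally show ?thesis using Q by simp
    qed
    then have "u 0 = 0\<^sub>v n" using u[of 0] by (intro eq_vecI) auto
    then show False using u0 by simp
  qed
  then obtain c where "c ^ Q = 1" "w c \<noteq> 0\<^sub>v n" by blast
  with eig[OF this(1)] show ?thesis
    unfolding w_def by (intro exI[of _ c] exI[of _ "\<lambda>k. c ^ (Q - k)"]) simp
qed

section \<open>Monomial matrices\<close>

text \<open>The matrix of \<open>y ^ j x ^ i\<close> in the basis
  \<open>v, y v, ..., y ^ (m - 1) v\<close>, where \<open>x v = z v\<close> and
  \<open>y ^ m v = c v\<close>: \<open>x ^ i\<close> scales the \<open>k\<close>-th vector,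
  \<open>y ^ j\<close> moves it to position \<open>j + k\<close>, and each wrap past
  \<open>m\<close> costs a factor \<open>c\<close>.\<close>

definition monomial_mat :: "nat \<Rightarrow> nat \<Rightarrow> complex \<Rightarrow> complex \<Rightarrow> nat \<Rightarrow> nat \<Rightarrow> complex mat" where
  "monomial_mat r m z c j i =
    mat m m (\<lambda>(l, k). if l = (j + k) mod m then z ^ (i * r ^ k) * c ^ ((j + k) div m) else 0)"

lemma monomial_mat_carrier [simp]: "monomial_mat r m z c j i \<in> carrier_mat m m"
  by (simp add: monomial_mat_def)

lemma monomial_mat_dim [simp]:
  "dim_row (monomial_mat r m z c j i) = m" "dim_col (monomial_mat r m z c j i) = m"
  by (simp_all add: monomial_mat_def)

lemma monomial_mat_one [simp]: "monomial_mat r m z c 0 0 = 1\<^sub>m m"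
  by (intro eq_matI) (auto simp: monomial_mat_def)

lemma power_orbit_mod:
  fixes z :: complex
  assumes "z ^ (r ^ m) = z"
  shows "z ^ (r ^ (a mod m)) = z ^ (r ^ a)"
proof -
  have *: "z ^ (r ^ (m * q)) = z" for q
    by (induction q) (simp_all add: power_add power_mult assms)
  have "z ^ (r ^ a) = z ^ (r ^ (m * (a div m) + a mod m))" by simp
  also have "\<dots> = z ^ (r ^ (a mod m))" by (simp only: power_add power_mult[of z] *)
  finally show ?thesis by simp
qed

text \<open>Mirrors the rule \<open>x ^ i y ^ j' = y ^ j' x ^ (i * r ^ j')\<close>. Each column has
  a single nonzero entry, and the carries of the two divisions by \<open>m\<close> add up.\<close>

lemma monomial_mat_mult:
  assumes m: "m > 0" and z: "z ^ (r ^ m) = z"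
  shows "monomial_mat r m z c j i * monomial_mat r m z c j' i' =
    monomial_mat r m z c (j + j') (i * r ^ j' + i')"
proof (rule eq_matI)
  fix l k assume "l < dim_row (monomial_mat r m z c (j + j') (i * r ^ j' + i'))"
    "k < dim_col (monomial_mat r m z c (j + j') (i * r ^ j' + i'))"
  then have l: "l < m" and k: "k < m" by simp_all
  \<comment> \<open>The row of the only nonzero entry in column \<open>k\<close> of the right
    factor.\<close>
  define a where "a = (j' + k) mod m"
  have a: "a < m" using m by (simp add: a_def)
  have "(monomial_mat r m z c j i * monomial_mat r m z c j' i') $$ (l, k) =
      (\<Sum>b<m. (if l = (j + b) mod m then z ^ (i * r ^ b) * c ^ ((j + b) div m) else 0) *
        (if b = a then z ^ (i' * r ^ k) * c ^ ((j' + k) div m) else 0))"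
    using l k by (auto simp: monomial_mat_def scalar_prod_def a_def atLeast0LessThan intro!: sum.cong)
  also have "\<dots> = (if l = (j + a) mod m then z ^ (i * r ^ a) * c ^ ((j + a) div m) else 0) *
        (z ^ (i' * r ^ k) * c ^ ((j' + k) div m))"
    using a by (subst sum.remove[of _ a]) (auto intro!: sum.neutral)
  also have "\<dots> = (if l = (j + j' + k) mod m
      then z ^ ((i * r ^ j' + i') * r ^ k) * c ^ ((j + j' + k) div m) else 0)"
  proof -
    have 1: "(j + a) mod m = (j + j' + k) mod m" by (simp add: a_def mod_add_right_eq add.assoc)
    have "j + j' + k = j + a + m * ((j' + k) div m)" by (simp add: a_def)
    then have 2: "(j + j' + k) div m = (j + a) div m + (j' + k) div m"
      using m by (metis add.commute div_mult_self2 not_less_zero)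
    have "z ^ (i * r ^ a) = z ^ (i * r ^ (j' + k))"
      using power_orbit_mod[OF z, of "j' + k"] unfolding a_def by (metis power_mult mult.commute)
    then show ?thesis unfolding 1 2 by (auto simp: power_add algebra_simps)
  qed
  finally show "(monomial_mat r m z c j i * monomial_mat r m z c j' i') $$ (l, k) =
      monomial_mat r m z c (j + j') (i * r ^ j' + i') $$ (l, k)"
    using l k by (simp add: monomial_mat_def)
qed simp_all

text \<open>The shift by \<open>j\<close> modulo \<open>m\<close> has a fixed point only if
  \<open>m\<close> divides \<open>j\<close>, and then it is the identity.\<close>

lemma mat_trace_monomial_mat:
  "mat_trace (monomial_mat r m z c j i) =
    (if m dvd j then c ^ (j div m) * (\<Sum>k<m. z ^ (i * r ^ k)) else 0)"
proof -
  have "mat_trace (monomial_mat r m z c j i) =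
      (\<Sum>k<m. if k = (j + k) mod m then z ^ (i * r ^ k) * c ^ ((j + k) div m) else 0)"
    by (simp add: mat_trace_def monomial_mat_def)
  also have "\<dots> = (\<Sum>k<m. if m dvd j then z ^ (i * r ^ k) * c ^ (j div m) else 0)"
  proof (intro sum.cong refl)
    fix k assume "k \<in> {..<m}"
    then have k: "k < m" by simp
    have "k = (j + k) mod m \<longleftrightarrow> m dvd j"
      using k cong_add_rcancel_0_nat[of j k m] by (auto simp: cong_def dvd_eq_mod_eq_0)
    moreover have "(j + k) div m = j div m" if "m dvd j"
      using that k by (auto elim!: dvdE)
    ultimately show "(if k = (j + k) mod m then z ^ (i * r ^ k) * c ^ ((j + k) div m) else 0) =
        (if m dvd j then z ^ (i * r ^ k) * c ^ (j div m) else 0)" by simp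
  qed
  finally show ?thesis by (simp add: sum_distrib_left mult.commute)
qed

lemma monomial_mat_unit_vec:
  assumes "k < m"
  shows "monomial_mat r m z c j i *\<^sub>v unit_vec m k =
    (z ^ (i * r ^ k) * c ^ ((j + k) div m)) \<cdot>\<^sub>v unit_vec m ((j + k) mod m)"
  using assms by (intro eq_vecI) (auto simp: monomial_mat_def)

lemma sum_geometric_root_unity:
  fixes q :: complex
  assumes "q ^ Q = 1" "q \<noteq> 1"
  shows "(\<Sum>i<Q. q ^ i) = 0"
  using assms by (simp add: sum_gp_strict)

text \<open>Averaging over the powers of the diagonal generator projects onto its one-dimensional
  eigenspaces, which the other generator permutes transitively.\<close>

lemma monomial_mat_irreducible:
  assumes W: "vec_subspace m W" and z: "z ^ K = 1" and K: "K > 0" and c: "c \<noteq> 0"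
    and distinct: "inj_on (\<lambda>k. z ^ (r ^ k)) {..<m}"
    and inv: "\<And>j i w. w \<in> W \<Longrightarrow> monomial_mat r m z c j i *\<^sub>v w \<in> W"
  shows "W = {0\<^sub>v m} \<or> W = carrier_vec m"
proof (rule disjCI)
  assume "W \<noteq> carrier_vec m"
  show "W = {0\<^sub>v m}"
  proof (rule ccontr)
    assume "W \<noteq> {0\<^sub>v m}"
    then obtain u where u: "u \<in> W" "u \<noteq> 0\<^sub>v m" using W by (auto simp: vec_subspace_iff)
    have uc: "u \<in> carrier_vec m" using u W by (auto simp: vec_subspace_iff)
    have z0: "z \<noteq> 0" using z K by (metis zero_neq_one power_0_left not_less_zero)
    have zK: "(z ^ a) ^ K = 1" for a using z by (metis mult.commute power_mult power_one)
    obtain k where k: "k < m" "u $ k \<noteq> 0"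
      using u uc by (metis eq_vecI carrier_vecD dim_vec index_zero_vec)
    have scale: "a \<cdot>\<^sub>v w \<in> W" if "w \<in> W" for a w using that W by (simp add: vec_subspace_iff)
    have *: "vec m (\<lambda>l. \<Sum>i<K. inverse (z ^ (i * r ^ k)) * (monomial_mat r m z c 0 i *\<^sub>v u) $ l) \<in> W"
      by (rule vec_subspace_sum[OF W]) (rule inv[OF u(1)])
    have entry: "(\<Sum>i<K. inverse (z ^ (i * r ^ k)) * (monomial_mat r m z c 0 i *\<^sub>v u) $ l) =
        (if l = k then of_nat K * u $ k else 0)" if l: "l < m" for l
    proof -
      have "(monomial_mat r m z c 0 i *\<^sub>v u) $ l = z ^ (i * r ^ l) * u $ l" for i
      proof -
        have "(monomial_mat r m z c 0 i *\<^sub>v u) $ l = (\<Sum>b<m. (if l = b then z ^ (i * r ^ b) else 0) * u $ b)"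
          using l uc by (auto simp: monomial_mat_def scalar_prod_def atLeast0LessThan intro!: sum.cong)
        also have "\<dots> = z ^ (i * r ^ l) * u $ l"
          using l by (subst sum.remove[of _ l]) (auto intro!: sum.neutral)
        finally show ?thesis .
      qed
      then have "(\<Sum>i<K. inverse (z ^ (i * r ^ k)) * (monomial_mat r m z c 0 i *\<^sub>v u) $ l) =
          (\<Sum>i<K. (z ^ (r ^ l) / z ^ (r ^ k)) ^ i) * u $ l"
        unfolding sum_distrib_right
        by (intro sum.cong refl)
          (simp add: power_mult_distrib power_inverse divide_inverse mult.commute[of _ "r ^ _"] power_mult)
      also have "\<dots> = (if l = k then of_nat K * u $ k else 0)"
      proof (cases "l = k")
        case False
        \<comment> \<open>Distinct points of the orbit have as quotient a nontrivial
          \<open>K\<close>-th root of unity, whose powers sum to zero.\<close>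
        have "(z ^ (r ^ l) / z ^ (r ^ k)) ^ K = 1"
          by (simp add: power_divide zK)
        moreover have "z ^ (r ^ l) / z ^ (r ^ k) \<noteq> 1"
          using inj_onD[OF distinct, of l k] False l k z0 by auto
        ultimately show ?thesis using False by (simp add: sum_geometric_root_unity)
      qed (use z0 in simp)
      finally show ?thesis .
    qed
    have "vec m (\<lambda>l. \<Sum>i<K. inverse (z ^ (i * r ^ k)) * (monomial_mat r m z c 0 i *\<^sub>v u) $ l) =
        (of_nat K * u $ k) \<cdot>\<^sub>v unit_vec m k"
      using entry k by (intro eq_vecI) (auto simp: unit_vec_def)
    with * have "(of_nat K * u $ k) \<cdot>\<^sub>v unit_vec m k \<in> W" by simp
    note scale[OF this, of "inverse (of_nat K * u $ k)"]
    moreover have "inverse (of_nat K * u $ k) * (of_nat K * u $ k) = 1"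
      by (rule left_inverse) (use k K in simp)
    ultimately have ek: "unit_vec m k \<in> W" by (simp only: smult_smult_assoc scalar_vec_one)
    have el: "unit_vec m l \<in> W" if l: "l < m" for l
    proof -
      \<comment> \<open>The shift by \<open>m - k + l\<close> carries position \<open>k\<close> to
        \<open>l\<close>; the summand \<open>m\<close> keeps the subtraction from
        truncating.\<close>
      have 1: "(m - k + l + k) mod m = l" using k l by simp
      have "monomial_mat r m z c (m - k + l) 0 *\<^sub>v unit_vec m k \<in> W" using inv[OF ek] .
      then have "c ^ ((m - k + l + k) div m) \<cdot>\<^sub>v unit_vec m l \<in> W"
        using monomial_mat_unit_vec[OF k(1), of r z c "m - k + l" 0] 1 by simp
      note scale[OF this, of "inverse (c ^ ((m - k + l + k) div m))"]
      moreover have "inverse (c ^ ((m - k + l + k) div m)) * c ^ ((m - k + l + k) div m) = 1"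
        by (rule left_inverse) (use c in simp)
      ultimately show ?thesis by (simp only: smult_smult_assoc scalar_vec_one)
    qed
    have "v \<in> W" if v: "v \<in> carrier_vec m" for v
    proof -
      have "vec m (\<lambda>l. \<Sum>i<m. v $ i * unit_vec m i $ l) \<in> W"
        by (rule vec_subspace_sum[OF W]) (rule el)
      moreover have "vec m (\<lambda>l. \<Sum>i<m. v $ i * unit_vec m i $ l) = v"
      proof (rule eq_vecI)
        fix l assume "l < dim_vec v"
        then have l: "l < m" using v by simp
        have "(\<Sum>i<m. v $ i * unit_vec m i $ l) = (\<Sum>i<m. if i = l then v $ l else 0)"
          using l by (intro sum.cong) (auto simp: unit_vec_def)
        then show "vec m (\<lambda>l. \<Sum>i<m. v $ i * unit_vec m i $ l) $ l = v $ l" using l by simp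
      qed (use v in simp)
      ultimately show ?thesis by simp
    qed
    then have "W = carrier_vec m" using W by (auto simp: vec_subspace_iff)
    then show False using \<open>W \<noteq> carrier_vec m\<close> by simp
  qed
qed

section \<open>Metacyclic presentations and their monomial representations\<close>

text \<open>\<open>y\<close> acts on the cyclic group generated by \<open>x\<close> by
  \<open>x \<mapsto> x ^ r\<close>, and \<open>y_pow_in_x\<close> makes \<open>M\<close> the exact
  order of \<open>y\<close> modulo that group. Exponents are natural numbers throughout.\<close>

locale metacyclic_presentation = group G for G (structure) +
  fixes x y and r s K M :: nat
  assumes x_closed [simp]: "x \<in> carrier G" and y_closed [simp]: "y \<in> carrier G"
    and K_pos: "K > 0" and M_pos: "M > 0"
    and x_pow_eq_one: "x [^] (i::nat) = \<one> \<longleftrightarrow> K dvd i"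
    and x_mult_y: "x \<otimes> y = y \<otimes> x [^] r"
    and y_pow_M: "y [^] M = x [^] s"
    and y_pow_in_x: "y [^] (j::nat) = x [^] (i::nat) \<Longrightarrow> M dvd j"
    and carrier_words: "g \<in> carrier G \<Longrightarrow> \<exists>(j::nat) i::nat. g = y [^] j \<otimes> x [^] i"
begin

section \<open>Normal forms of group elements\<close>

definition word :: "nat \<Rightarrow> nat \<Rightarrow> 'a" where
  "word j i = y [^] j \<otimes> x [^] i"

lemma word_closed [simp]: "word j i \<in> carrier G"
  by (simp add: word_def)

lemma ex_word: "g \<in> carrier G \<Longrightarrow> \<exists>j i. g = word j i"
  using carrier_words by (simp add: word_def)

lemma x_pow_y: "x [^] (i::nat) \<otimes> y = y \<otimes> x [^] (i * r)"
proof (induction i)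
  case (Suc i)
  have "x [^] Suc i \<otimes> y = x [^] i \<otimes> (x \<otimes> y)" by (simp add: m_assoc)
  also have "\<dots> = (x [^] i \<otimes> y) \<otimes> x [^] r" by (simp add: x_mult_y m_assoc)
  also have "\<dots> = y \<otimes> x [^] (Suc i * r)" by (simp add: Suc m_assoc nat_pow_mult add.commute)
  finally show ?case .
qed simp

lemma x_pow_y_pow: "x [^] (i::nat) \<otimes> y [^] (j::nat) = y [^] j \<otimes> x [^] (i * r ^ j)"
proof (induction j)
  case (Suc j)
  have "x [^] i \<otimes> y [^] Suc j = (x [^] i \<otimes> y [^] j) \<otimes> y" by (simp add: m_assoc)
  also have "\<dots> = y [^] j \<otimes> (x [^] (i * r ^ j) \<otimes> y)" by (simp add: Suc m_assoc)
  also have "\<dots> = y [^] Suc j \<otimes> x [^] (i * r ^ Suc j)"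
    by (simp add: x_pow_y m_assoc mult_ac)
  finally show ?case .
qed simp

lemma word_mult: "word j i \<otimes> word j' i' = word (j + j') (i * r ^ j' + i')"
proof -
  have "word j i \<otimes> word j' i' = y [^] j \<otimes> (x [^] i \<otimes> y [^] j') \<otimes> x [^] i'"
    by (simp add: word_def m_assoc)
  also have "\<dots> = (y [^] j \<otimes> y [^] j') \<otimes> (x [^] (i * r ^ j') \<otimes> x [^] i')"
    by (simp add: x_pow_y_pow m_assoc)
  finally show ?thesis by (simp add: nat_pow_mult word_def)
qed

lemma word_0_0 [simp]: "word 0 0 = \<one>"
  by (simp add: word_def)

lemma x_pow_eq_iff: "x [^] (a::nat) = x [^] (b::nat) \<longleftrightarrow> [a = b] (mod K)"
proof (induction a b rule: linorder_wlog)
  case (le a b)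
  have "x [^] b = x [^] a \<otimes> x [^] (b - a)" using le by (simp add: nat_pow_mult)
  then have "x [^] a = x [^] b \<longleftrightarrow> K dvd b - a"
    by (simp add: x_pow_eq_one)
  also have "\<dots> \<longleftrightarrow> [a = b] (mod K)"
    using cong_altdef_nat[OF le, of K] cong_sym_eq[of a b K] by simp
  finally show ?case .
next
  case (sym a b)
  then show ?case by (simp add: eq_commute[of "x [^] a"] cong_sym_eq[of a])
qed

text \<open>\<open>y ^ M\<close> is a power of \<open>x\<close>, so conjugation by it fixes
  \<open>x\<close>.\<close>

lemma r_pow_M_cong: "[r ^ M = 1] (mod K)"
proof -
  have "x [^] s \<otimes> x [^] (r ^ M) = x [^] (1::nat) \<otimes> y [^] M"
    using x_pow_y_pow[of 1 M] by (simp add: y_pow_M)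
  also have "\<dots> = x [^] s \<otimes> x [^] (1::nat)"
    by (simp only: y_pow_M nat_pow_mult x_closed add.commute)
  finally have "x [^] (r ^ M) = x [^] (1::nat)"
    by (simp only: Units_eq Units_l_cancel x_closed nat_pow_closed)
  then show ?thesis by (rule x_pow_eq_iff[THEN iffD1])
qed

text \<open>\<open>x ^ s = y ^ M\<close> commutes with \<open>y\<close>.\<close>

lemma s_mult_r_cong: "[s * r = s] (mod K)"
proof -
  have "y \<otimes> x [^] (s * r) = y [^] M \<otimes> y" by (simp add: y_pow_M x_pow_y)
  also have "\<dots> = y \<otimes> y [^] M" using nat_pow_mult[of y M 1] nat_pow_mult[of y 1 M] by simp
  finally show ?thesis by (simp add: y_pow_M x_pow_eq_iff)
qed

lemma s_mult_r_pow_cong: "[s * r ^ k = s] (mod K)"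
proof (induction k)
  case (Suc k)
  have "[s * r * r ^ k = s * r ^ k] (mod K)" by (rule cong_scalar_right[OF s_mult_r_cong])
  also note Suc
  finally show ?case by (simp only: power_Suc mult.assoc)
qed simp

text \<open>Cancelling \<open>y ^ j\<close> leaves a power of \<open>y\<close> among the powers of
  \<open>x\<close>, so \<open>M\<close> divides its exponent and \<open>y ^ (M * q)\<close> can be
  traded for \<open>x ^ (s * q)\<close>. Ordering \<open>j\<close> and \<open>j'\<close> keeps
  \<open>q\<close> a natural number.\<close>

lemma word_eq_iff:
  assumes "j \<le> j'"
  shows "word j i = word j' i' \<longleftrightarrow> (\<exists>q. j' = j + M * q \<and> [i = s * q + i'] (mod K))"
proof -
  have "y [^] j' = y [^] j \<otimes> y [^] (j' - j)" using assms by (simp add: nat_pow_mult)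
  then have split: "word j' i' = y [^] j \<otimes> (y [^] (j' - j) \<otimes> x [^] i')"
    by (simp add: word_def m_assoc)
  have pow: "y [^] (M * q) = x [^] (s * q)" for q
    by (simp add: y_pow_M flip: nat_pow_pow)
  have "word j i = word j' i' \<longleftrightarrow> x [^] i = y [^] (j' - j) \<otimes> x [^] i'"
    unfolding split by (simp add: word_def)
  also have "\<dots> \<longleftrightarrow> (\<exists>q. j' = j + M * q \<and> [i = s * q + i'] (mod K))"
  proof
    assume e: "x [^] i = y [^] (j' - j) \<otimes> x [^] i'"
    \<comment> \<open>\<open>x ^ (i' * (K - 1))\<close> serves as the inverse of
      \<open>x ^ i'\<close>.\<close>
    have "i' + i' * (K - 1) = K * i'" using K_pos by (cases K) simp_all
    then have "x [^] i' \<otimes> x [^] (i' * (K - 1)) = \<one>"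
      by (simp only: nat_pow_mult x_closed x_pow_eq_one dvd_triv_left)
    then have "y [^] (j' - j) = x [^] i \<otimes> x [^] (i' * (K - 1))"
      using e by (simp add: m_assoc)
    then have "M dvd j' - j" using y_pow_in_x by (simp add: nat_pow_mult)
    then obtain q where q: "j' - j = M * q" by (elim dvdE)
    then have "x [^] i = x [^] (s * q + i')" using e pow by (simp add: nat_pow_mult)
    then show "\<exists>q. j' = j + M * q \<and> [i = s * q + i'] (mod K)"
      using q assms x_pow_eq_iff by (metis le_add_diff_inverse)
  next
    assume "\<exists>q. j' = j + M * q \<and> [i = s * q + i'] (mod K)"
    then obtain q where q: "j' = j + M * q" "[i = s * q + i'] (mod K)" by blast
    then have "x [^] i = x [^] (s * q + i')" by (simp only: x_pow_eq_iff)
    then show "x [^] i = y [^] (j' - j) \<otimes> x [^] i'" using q pow by (simp add: nat_pow_mult)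
  qed
  finally show ?thesis .
qed

lemma word_bij: "bij_betw (\<lambda>(j, i). word j i) ({..<M} \<times> {..<K}) (carrier G)"
proof (rule bij_betw_imageI)
  have eq: "(j, i) = (j', i')"
    if le: "j \<le> j'" and lt: "j' < M" "i < K" "i' < K" and w: "word j i = word j' i'"
    for j i j' i'
  proof -
    obtain q where q: "j' = j + M * q" "[i = s * q + i'] (mod K)"
      using w word_eq_iff[OF le] by blast
    then have "q = 0" using lt by (cases q) auto
    then show ?thesis using q lt by (simp add: cong_less_modulus_unique_nat)
  qed
  show "inj_on (\<lambda>(j, i). word j i) ({..<M} \<times> {..<K})"
  proof (rule inj_onI)
    fix a b
    assume *: "a \<in> {..<M} \<times> {..<K}" "b \<in> {..<M} \<times> {..<K}"
      "(\<lambda>(j, i). word j i) a = (\<lambda>(j, i). word j i) b"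
    show "a = b"
    proof (cases "fst a \<le> fst b")
      case True
      then show ?thesis using eq[of "fst a" "fst b" "snd a" "snd b"] * by (auto simp: case_prod_beta)
    next
      case False
      then show ?thesis using eq[of "fst b" "fst a" "snd b" "snd a"] * by (auto simp: case_prod_beta)
    qed
  qed
  have "g \<in> (\<lambda>(j, i). word j i) ` ({..<M} \<times> {..<K})" if g: "g \<in> carrier G" for g
  proof -
    obtain j i where "g = word j i" using carrier_words[OF g] by (auto simp: word_def)
    \<comment> \<open>Reduce \<open>j\<close> modulo \<open>M\<close>, turning the quotient into a
      power of \<open>x\<close>.\<close>
    moreover have "word (j mod M) ((s * (j div M) + i) mod K) = word j i"
      by (subst word_eq_iff) (auto intro!: exI[of _ "j div M"] simp: cong_def)
    ultimately show ?thesis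
      using K_pos M_pos by (force intro!: rev_image_eqI[of "(j mod M, (s * (j div M) + i) mod K)"])
  qed
  then show "(\<lambda>(j, i). word j i) ` ({..<M} \<times> {..<K}) = carrier G" by auto
qed

lemma finite_carrier: "finite (carrier G)"
  using bij_betw_finite[OF word_bij] by simp

lemma order_eq: "Coset.order G = M * K"
  using bij_betw_same_card[OF word_bij] by (simp add: Coset.order_def card_cartesian_product)

lemma root_power_cong:
  fixes z :: complex
  assumes "z ^ K = 1" "[a = b] (mod K)"
  shows "z ^ a = z ^ b"
proof -
  have "z ^ a = z ^ (a mod K)" for a
    by (metis assms(1) mod_mult_div_eq mult_1_right power_add power_mult power_one)
  then show ?thesis using assms(2) by (metis cong_def)
qed

section \<open>Orbits under the \<open>r\<close>-th power map\<close>

text \<open>For a \<open>K\<close>-th root of unity this first return time is the full orbit length,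
  since \<open>r\<close> is invertible modulo \<open>K\<close>.\<close>

definition orbit_size :: "complex \<Rightarrow> nat" where
  "orbit_size z = (LEAST m. 0 < m \<and> z ^ (r ^ m) = z)"

context
  fixes z :: complex
  assumes z: "z ^ K = 1"
begin

lemma z_nonzero: "z \<noteq> 0"
  using z K_pos by (metis zero_neq_one power_0_left not_less_zero)

lemma z_pow_s: "z ^ (s * r ^ k) = z ^ s"
  using root_power_cong[OF z s_mult_r_pow_cong] .

lemma orbit_size_pos: "orbit_size z > 0" and orbit_size_fix: "z ^ (r ^ orbit_size z) = z"
proof -
  have "0 < M \<and> z ^ (r ^ M) = z"
    using M_pos root_power_cong[OF z r_pow_M_cong] by simp
  from LeastI[where P = "\<lambda>m. 0 < m \<and> z ^ (r ^ m) = z", OF this]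
  show "orbit_size z > 0" "z ^ (r ^ orbit_size z) = z" by (simp_all add: orbit_size_def)
qed

lemma orbit_size_dvd_iff: "z ^ (r ^ a) = z \<longleftrightarrow> orbit_size z dvd a"
proof
  assume "z ^ (r ^ a) = z"
  then have "z ^ (r ^ (a mod orbit_size z)) = z"
    using power_orbit_mod[OF orbit_size_fix] by simp
  moreover have "a mod orbit_size z < orbit_size z" using orbit_size_pos by simp
  ultimately show "orbit_size z dvd a"
    using not_less_Least[of "a mod orbit_size z" "\<lambda>m. 0 < m \<and> z ^ (r ^ m) = z"]
    by (auto simp: orbit_size_def[symmetric] dvd_eq_mod_eq_0)
next
  assume "orbit_size z dvd a"
  then show "z ^ (r ^ a) = z" using power_orbit_mod[OF orbit_size_fix, of a] by simp
qed

lemma orbit_size_dvd_M: "orbit_size z dvd M"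
  using orbit_size_dvd_iff root_power_cong[OF z r_pow_M_cong] by simp

text \<open>If two iterates coincided, pushing the earlier one on until it reaches \<open>z\<close>
  again would give a return to \<open>z\<close> after fewer than \<open>orbit_size z\<close>
  steps.\<close>

lemma orbit_distinct: "inj_on (\<lambda>k. z ^ (r ^ k)) {..<orbit_size z}"
proof (rule linorder_inj_onI)
  fix a b assume ab: "a < b" "a \<in> {..<orbit_size z}" "b \<in> {..<orbit_size z}"
  show "z ^ (r ^ a) \<noteq> z ^ (r ^ b)"
  proof
    assume "z ^ (r ^ a) = z ^ (r ^ b)"
    then have "(z ^ (r ^ a)) ^ (r ^ (orbit_size z - a)) = (z ^ (r ^ b)) ^ (r ^ (orbit_size z - a))"
      by simp
    then have "z ^ (r ^ orbit_size z) = z ^ (r ^ (b - a + orbit_size z))"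
      using ab by (simp flip: power_mult power_add)
    then have "z ^ (r ^ (b - a + orbit_size z)) = z" using orbit_size_fix by simp
    then have "orbit_size z dvd b - a" by (simp add: orbit_size_dvd_iff)
    then show False using ab by (auto dest: dvd_imp_le)
  qed
qed auto

end

section \<open>Monomial representations of the group\<close>

text \<open>With \<open>m = orbit_size z\<close>, \<open>c\<close> is the eigenvalue of
  \<open>y ^ m\<close>; the second condition is the relation \<open>y ^ M = x ^ s\<close> evaluated
  on the eigenvector.\<close>

definition admissible :: "complex \<Rightarrow> complex \<Rightarrow> bool" where
  "admissible z c \<longleftrightarrow> z ^ K = 1 \<and> c ^ (M div orbit_size z) = z ^ s"

text \<open>An element has many words, so one is picked by \<open>SOME\<close>;
  \<open>monomial_mat_word_cong\<close> shows that the choice is immaterial.\<close>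

definition monomial_rep :: "complex \<Rightarrow> complex \<Rightarrow> 'a \<Rightarrow> complex mat" where
  "monomial_rep z c g =
    (case SOME (j, i). g = word j i of (j, i) \<Rightarrow> monomial_mat r (orbit_size z) z c j i)"

definition monomial_char :: "complex \<Rightarrow> complex \<Rightarrow> 'a \<Rightarrow> complex" where
  "monomial_char z c = character_of G (monomial_rep z c)"

lemma admissible_root: "admissible z c \<Longrightarrow> z ^ K = 1"
  by (simp add: admissible_def)

context
  fixes z c :: complex
  assumes adm: "admissible z c"
begin

lemma admissible_nonzero: "c \<noteq> 0"
proof
  assume "c = 0"
  moreover have "M div orbit_size z > 0"
    using orbit_size_dvd_M[OF admissible_root[OF adm]] orbit_size_pos[OF admissible_root[OF adm]] M_pos by (simp add: div_greater_zero_iff dvd_imp_le)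
  ultimately have "z ^ s = 0" using adm unfolding admissible_def by (metis zero_power)
  then show False using z_nonzero[OF admissible_root[OF adm]] by simp
qed

text \<open>Trading \<open>x ^ (s * q)\<close> for \<open>y ^ (M * q)\<close> replaces a factor
  \<open>z ^ (s * q)\<close> by the corresponding power of \<open>c\<close>, which is the same
  number by admissibility. As \<open>z ^ (s * r ^ k) = z ^ s\<close>, it does not depend on the
  column.\<close>

lemma monomial_mat_word_cong:
  assumes "j \<le> j'" "word j i = word j' i'"
  shows "monomial_mat r (orbit_size z) z c j i = monomial_mat r (orbit_size z) z c j' i'"
proof -
  obtain q where q: "j' = j + M * q" "[i = s * q + i'] (mod K)"
    using assms(2) word_eq_iff[OF assms(1)] by blast
  obtain d where d: "M = orbit_size z * d" using orbit_size_dvd_M[OF admissible_root[OF adm]] by (elim dvdE)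
  have "M div orbit_size z = d" using d orbit_size_pos[OF admissible_root[OF adm]] by simp
  then have cd: "c ^ d = z ^ s" using adm by (simp add: admissible_def)
  have j': "j' + k = j + k + orbit_size z * (d * q)" for k using q d by simp
  have "(j' + k) mod orbit_size z = (j + k) mod orbit_size z" for k by (simp only: j' mod_mult_self2)
  moreover have "(j' + k) div orbit_size z = (j + k) div orbit_size z + d * q" for k
    using orbit_size_pos[OF admissible_root[OF adm]] by (simp only: j') simp
  moreover have "z ^ (i * r ^ k) = z ^ (i' * r ^ k) * c ^ (d * q)" for k
  proof -
    have "[i * r ^ k = (s * q + i') * r ^ k] (mod K)" using q(2) by (rule cong_scalar_right)
    then have "z ^ (i * r ^ k) = z ^ ((s * q + i') * r ^ k)" by (rule root_power_cong[OF admissible_root[OF adm]])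
    also have "\<dots> = (z ^ (s * r ^ k)) ^ q * z ^ (i' * r ^ k)"
      by (simp add: algebra_simps power_add flip: power_mult)
    also have "(z ^ (s * r ^ k)) ^ q = c ^ (d * q)" unfolding z_pow_s[OF admissible_root[OF adm]] by (simp add: cd power_mult)
    finally show ?thesis by simp
  qed
  ultimately show ?thesis
    unfolding monomial_mat_def by (intro cong_mat) (auto simp: power_add)
qed

lemma monomial_rep_word: "monomial_rep z c (word j i) = monomial_mat r (orbit_size z) z c j i"
proof -
  obtain j' i' where e: "(SOME (j', i'). word j i = word j' i') = (j', i')" by (meson surj_pair)
  have "word j i = word j' i'"
    using someI[of "\<lambda>(j', i'). word j i = word j' i'" "(j, i)"] unfolding e by simp
  then have "monomial_mat r (orbit_size z) z c j i = monomial_mat r (orbit_size z) z c j' i'"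
    using monomial_mat_word_cong[of j j' i i'] monomial_mat_word_cong[of j' j i' i] by (metis nle_le)
  then show ?thesis by (simp add: monomial_rep_def e)
qed

lemma monomial_rep_mult:
  assumes "g \<in> carrier G" "h \<in> carrier G"
  shows "monomial_rep z c (g \<otimes> h) = monomial_rep z c g * monomial_rep z c h"
  using ex_word[OF assms(1)] ex_word[OF assms(2)] orbit_size_pos[OF admissible_root[OF adm]] orbit_size_fix[OF admissible_root[OF adm]]
  by (auto simp: word_mult monomial_rep_word monomial_mat_mult)

lemma monomial_rep_carrier:
  "g \<in> carrier G \<Longrightarrow> monomial_rep z c g \<in> carrier_mat (orbit_size z) (orbit_size z)"
  using ex_word[of g] by (auto simp: monomial_rep_word)

lemma monomial_rep_one: "monomial_rep z c \<one> = 1\<^sub>m (orbit_size z)"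
  using monomial_rep_word[of 0 0] by simp

lemma monomial_rep_representation: "monomial_rep z c \<in> representations G (orbit_size z)"
proof -
  have "monomial_rep z c g \<in> Units (ring_mat TYPE(complex) (orbit_size z) ())"
    if g: "g \<in> carrier G" for g
    using g monomial_rep_carrier[OF g] monomial_rep_carrier[of "inv g"]
      monomial_rep_mult[of g "inv g"] monomial_rep_mult[of "inv g" g]
    by (auto simp: Units_def ring_mat_simps monomial_rep_one intro!: bexI[of _ "monomial_rep z c (inv g)"])
  then show ?thesis
    by (auto simp: representations_def hom_def units_of_def ring_mat_simps monomial_rep_mult)
qed

lemma monomial_rep_irreducible:
  "irreducible_representation G (orbit_size z) (monomial_rep z c)"
  unfolding irreducible_representation_def
proof (intro conjI allI impI)
  fix W
  assume W: "vec_subspace (orbit_size z) W"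
    and inv: "\<forall>g\<in>carrier G. \<forall>w\<in>W. monomial_rep z c g *\<^sub>v w \<in> W"
  have "monomial_mat r (orbit_size z) z c j i *\<^sub>v w \<in> W" if "w \<in> W" for j i w
    using inv that by (metis monomial_rep_word word_closed)
  then show "W = {0\<^sub>v (orbit_size z)} \<or> W = carrier_vec (orbit_size z)"
    using monomial_mat_irreducible[OF W admissible_root[OF adm] K_pos admissible_nonzero orbit_distinct[OF admissible_root[OF adm]]] by blast
qed (simp_all add: monomial_rep_representation orbit_size_pos admissible_root[OF adm])

lemma monomial_char_in_Irr: "monomial_char z c \<in> Irr G"
  unfolding Irr_def monomial_char_def using monomial_rep_irreducible by blast

lemma monomial_char_word: "monomial_char z c (word j i) =
    (if orbit_size z dvd j then c ^ (j div orbit_size z) * (\<Sum>k<orbit_size z. z ^ (i * r ^ k)) else 0)"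
  by (simp add: monomial_char_def character_of_def monomial_rep_word mat_trace_monomial_mat)

lemma monomial_char_one: "monomial_char z c \<one> = of_nat (orbit_size z)"
  using monomial_char_word[of 0 0] by simp

end

end

section \<open>Classification of the irreducible characters\<close>

context metacyclic_presentation
begin

text \<open>Schur's argument for the matrix \<open>P\<close> with columns
  \<open>v, y v, ..., y ^ (m - 1) v\<close>: it intertwines \<rho> with a monomial representation,
  its image is a nonzero invariant subspace and its kernel a proper one. Irreducibility on both
  sides makes \<open>P\<close> invertible, so the traces agree.\<close>

lemma irreducible_character_monomial:
  assumes irr: "irreducible_representation G n \<rho>"
  shows "\<exists>z c. admissible z c \<and> character_of G \<rho> = monomial_char z c"
proof -
  have n: "n > 0" and rep: "\<rho> \<in> representations G n"
    and irrD: "\<And>W. vec_subspace n W \<Longrightarrow> (\<And>g w. g \<in> carrier G \<Longrightarrow> w \<in> W \<Longrightarrow> \<rho> g *\<^sub>v w \<in> W) \<Longrightarrow>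
        W = {0\<^sub>v n} \<or> W = carrier_vec n"
    using irr unfolding irreducible_representation_def by blast+
  have \<rho>_unit: "\<rho> g \<in> Units (ring_mat TYPE(complex) n ())" if "g \<in> carrier G" for g
    using rep that by (auto simp: representations_def hom_def units_of_def)
  then have \<rho>_carrier [simp]: "\<rho> g \<in> carrier_mat n n" if "g \<in> carrier G" for g
    using that by (auto simp: Units_def ring_mat_simps)
  have \<rho>_dim [simp]: "dim_row (\<rho> g) = n" "dim_col (\<rho> g) = n" if "g \<in> carrier G" for g
    using \<rho>_carrier[OF that] by auto
  have \<rho>_mult: "\<rho> (g \<otimes> h) = \<rho> g * \<rho> h" if "g \<in> carrier G" "h \<in> carrier G" for g h
    using rep that by (auto simp: representations_def hom_def units_of_def ring_mat_simps)
  have \<rho>_one: "\<rho> \<one> = 1\<^sub>m n"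
  proof -
    obtain R where R: "R \<in> carrier_mat n n" "R * \<rho> \<one> = 1\<^sub>m n"
      using \<rho>_unit[of \<one>] by (auto simp: Units_def ring_mat_simps)
    have "\<rho> \<one> = (R * \<rho> \<one>) * \<rho> \<one>"
      by (simp add: R(2) left_mult_one_mat[OF \<rho>_carrier])
    also have "\<dots> = R * \<rho> (\<one> \<otimes> \<one>)"
      by (simp only: \<rho>_mult one_closed assoc_mult_mat[OF R(1) \<rho>_carrier \<rho>_carrier])
    finally show ?thesis using R by simp
  qed
  have act: "\<rho> (g \<otimes> h) *\<^sub>v v = \<rho> g *\<^sub>v (\<rho> h *\<^sub>v v)"
    if "g \<in> carrier G" "h \<in> carrier G" "v \<in> carrier_vec n" for g h v
    using that by (simp add: \<rho>_mult assoc_mult_mat_vec[OF \<rho>_carrier \<rho>_carrier])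
  have closed [simp]: "\<rho> g *\<^sub>v v \<in> carrier_vec n" if "g \<in> carrier G" "v \<in> carrier_vec n" for g v
    by (rule mult_mat_vec_carrier[OF \<rho>_carrier[OF that(1)] that(2)])
  have lin: "\<rho> g *\<^sub>v (a \<cdot>\<^sub>v v) = a \<cdot>\<^sub>v (\<rho> g *\<^sub>v v)"
    if "g \<in> carrier G" "v \<in> carrier_vec n" for g v a
    by (rule mult_mat_vec[OF \<rho>_carrier[OF that(1)] that(2)])
  have eig_pow: "\<rho> (g [^] (i::nat)) *\<^sub>v v = a ^ i \<cdot>\<^sub>v v"
    if g: "g \<in> carrier G" and v: "v \<in> carrier_vec n" and e: "\<rho> g *\<^sub>v v = a \<cdot>\<^sub>v v" for g v a i
  proof (induction i)
    case (Suc i)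
    have "\<rho> (g [^] Suc i) *\<^sub>v v = \<rho> (g [^] i) *\<^sub>v (a \<cdot>\<^sub>v v)" using g v e by (simp add: act)
    also have "\<dots> = a ^ Suc i \<cdot>\<^sub>v v"
      using g v Suc by (simp add: lin smult_smult_assoc)
    finally show ?case .
  qed (use v in \<open>simp add: \<rho>_one\<close>)
  obtain z u where u: "u \<in> carrier_vec n" "u \<noteq> 0\<^sub>v n" and xu: "\<rho> x *\<^sub>v u = z \<cdot>\<^sub>v u"
  proof -
    let ?u = "\<lambda>k. \<rho> (x [^] (k::nat)) *\<^sub>v unit_vec n 0"
    have "\<exists>c a. vec n (\<lambda>l. \<Sum>k<K. a k * ?u k $ l) \<noteq> 0\<^sub>v n \<and>
      \<rho> x *\<^sub>v vec n (\<lambda>l. \<Sum>k<K. a k * ?u k $ l) = c \<cdot>\<^sub>v vec n (\<lambda>l. \<Sum>k<K. a k * ?u k $ l)"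
    proof (rule exists_eigenvector_averaging)
      show "?u (Suc k) = \<rho> x *\<^sub>v ?u k" for k
        using act[of x "x [^] k"] by (simp add: nat_pow_mult[of x 1, simplified] flip: nat_pow_Suc2)
      show "?u K = ?u 0" using x_pow_eq_one[of K] by simp
      show "?u 0 \<noteq> 0\<^sub>v n" using n by (simp add: \<rho>_one)
    qed (simp_all add: K_pos closed)
    then obtain c a where "vec n (\<lambda>l. \<Sum>k<K. a k * ?u k $ l) \<noteq> 0\<^sub>v n"
      "\<rho> x *\<^sub>v vec n (\<lambda>l. \<Sum>k<K. a k * ?u k $ l) = c \<cdot>\<^sub>v vec n (\<lambda>l. \<Sum>k<K. a k * ?u k $ l)"
      by blast
    then show thesis using that[OF vec_carrier] by blast
  qed
  have z: "z ^ K = 1"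
    using eig_pow[OF x_closed u(1) xu, of K] x_pow_eq_one[of K] u
    by (intro smult_vec_cancel[OF u]) (simp add: \<rho>_one)
  define m where "m = orbit_size z"
  note m_pos = orbit_size_pos[OF z, folded m_def] and m_fix = orbit_size_fix[OF z, folded m_def]
    and m_dvd = orbit_size_dvd_M[OF z, folded m_def]
  have x_on: "\<rho> (x [^] i) *\<^sub>v (\<rho> (y [^] j) *\<^sub>v v) = z ^ (i * r ^ j) \<cdot>\<^sub>v (\<rho> (y [^] j) *\<^sub>v v)"
    if v: "v \<in> carrier_vec n" "\<rho> x *\<^sub>v v = z \<cdot>\<^sub>v v" for i j :: nat and v
  proof -
    have "\<rho> (x [^] i) *\<^sub>v (\<rho> (y [^] j) *\<^sub>v v) = \<rho> (x [^] i \<otimes> y [^] j) *\<^sub>v v"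
      using v by (simp add: act)
    also have "\<dots> = \<rho> (y [^] j) *\<^sub>v (\<rho> (x [^] (i * r ^ j)) *\<^sub>v v)"
      using v by (simp add: x_pow_y_pow act)
    also have "\<dots> = z ^ (i * r ^ j) \<cdot>\<^sub>v (\<rho> (y [^] j) *\<^sub>v v)"
      using v eig_pow[OF x_closed v] by (simp add: lin)
    finally show ?thesis .
  qed

  \<comment> \<open>Translates of \<open>u\<close> by powers of \<open>y ^ m\<close> stay in the
    \<open>z\<close>-eigenspace of \<open>x\<close>; averaging them gives an eigenvector of
    \<open>y ^ m\<close> inside it.\<close>
  obtain c v where v: "v \<in> carrier_vec n" "v \<noteq> 0\<^sub>v n" and xv: "\<rho> x *\<^sub>v v = z \<cdot>\<^sub>v v"
    and yv: "\<rho> (y [^] m) *\<^sub>v v = c \<cdot>\<^sub>v v"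
  proof -
    let ?u = "\<lambda>k. \<rho> (y [^] (m * k)) *\<^sub>v u"
    let ?w = "\<lambda>a. vec n (\<lambda>l. \<Sum>k<M*K. a k * ?u k $ l)"
    have "\<exists>c a. ?w a \<noteq> 0\<^sub>v n \<and> \<rho> (y [^] m) *\<^sub>v ?w a = c \<cdot>\<^sub>v ?w a"
    proof (rule exists_eigenvector_averaging)
      show "?u (Suc k) = \<rho> (y [^] m) *\<^sub>v ?u k" for k
        using act[of "y [^] m" "y [^] (m * k)" u] u by (simp add: nat_pow_mult)
      \<comment> \<open>\<open>M * K\<close> is a period of the translates because
        \<open>y ^ (M * K) = x ^ (s * K)\<close> is trivial.\<close>
      have "y [^] (M * (K * m)) = (y [^] M) [^] (K * m)" by (simp add: nat_pow_pow)
      also have "\<dots> = x [^] (K * (s * m))" by (simp add: y_pow_M nat_pow_pow mult_ac)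
      also have "\<dots> = \<one>" by (simp only: x_pow_eq_one dvd_triv_left)
      finally show "?u (M * K) = ?u 0" by (simp add: mult_ac)
      show "?u 0 \<noteq> 0\<^sub>v n" using u by (simp add: \<rho>_one)
    qed (use u in \<open>simp_all add: K_pos M_pos closed\<close>)
    then obtain c a where a: "?w a \<noteq> 0\<^sub>v n" "\<rho> (y [^] m) *\<^sub>v ?w a = c \<cdot>\<^sub>v ?w a" by blast
    have "?w a \<in> {v \<in> carrier_vec n. \<rho> x *\<^sub>v v = z \<cdot>\<^sub>v v}"
    proof (rule vec_subspace_sum[OF vec_subspace_eigenspace])
      fix k
      have "z ^ (r ^ (m * k)) = z"
        using orbit_size_dvd_iff[OF z, of "m * k"] by (simp add: m_def)
      then show "?u k \<in> {v \<in> carrier_vec n. \<rho> x *\<^sub>v v = z \<cdot>\<^sub>v v}"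
        using x_on[OF u(1) xu, of 1 "m * k"] u by (simp add: closed)
    qed simp
    then show thesis using that a by blast
  qed
  have adm: "admissible z c"
  proof -
    obtain d where d: "M = m * d" using m_dvd by (elim dvdE)
    have "c ^ d \<cdot>\<^sub>v v = \<rho> (x [^] s) *\<^sub>v v"
      using eig_pow[OF _ v(1) yv, of d] by (simp add: nat_pow_pow d[symmetric] y_pow_M)
    also have "\<dots> = z ^ s \<cdot>\<^sub>v v" using eig_pow[OF x_closed v(1) xv] .
    finally have e: "c ^ d \<cdot>\<^sub>v v = z ^ s \<cdot>\<^sub>v v" .
    have "c ^ d = z ^ s" by (rule smult_vec_cancel[OF v e])
    moreover have "M div m = d" using d m_pos by simp
    ultimately show ?thesis using z by (simp add: admissible_def m_def)
  qed
  have y_on: "\<rho> (y [^] a) *\<^sub>v v = c ^ (a div m) \<cdot>\<^sub>v (\<rho> (y [^] (a mod m)) *\<^sub>v v)" for a :: nat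
  proof -
    have "y [^] a = y [^] (a mod m) \<otimes> (y [^] m) [^] (a div m)"
      by (simp add: nat_pow_pow nat_pow_mult)
    then show ?thesis
      using v eig_pow[OF _ v(1) yv, of "a div m"] by (simp add: act lin)
  qed

  define F where "F j i = monomial_mat r m z c j i" for j i
  have F: "F j i \<in> carrier_mat m m" for j i by (simp add: F_def)
  define P where "P = mat n m (\<lambda>(l, k). (\<rho> (y [^] k) *\<^sub>v v) $ l)"
  have P: "P \<in> carrier_mat n m" by (simp add: P_def)
  have col_unit: "A *\<^sub>v unit_vec b k = col A k" if "A \<in> carrier_mat a b" "k < b"
    for A :: "complex mat" and a b k
    using that by (intro eq_vecI) auto
  have P_unit: "P *\<^sub>v unit_vec m k = \<rho> (y [^] k) *\<^sub>v v" if "k < m" for k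
    using that v by (subst col_unit[OF P that]) (auto simp: P_def)
  have inter: "\<rho> (word j i) * P = P * F j i" for j i
  proof (rule mat_col_eqI)
    fix k assume "k < dim_col (P * F j i)"
    then have k: "k < m" by (simp add: F_def)
    have "col (\<rho> (word j i) * P) k = \<rho> (word j i) *\<^sub>v (P *\<^sub>v unit_vec m k)"
      using k P by (subst col_unit[symmetric, of _ n m])
        (auto simp: assoc_mult_mat_vec[OF \<rho>_carrier P])
    also have "\<dots> = \<rho> (y [^] j) *\<^sub>v (\<rho> (x [^] i) *\<^sub>v (\<rho> (y [^] k) *\<^sub>v v))"
      using k v by (simp add: P_unit word_def act)
    also have "\<dots> = z ^ (i * r ^ k) \<cdot>\<^sub>v (\<rho> (y [^] j) *\<^sub>v (\<rho> (y [^] k) *\<^sub>v v))"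
      using v by (subst x_on[OF v(1) xv]) (simp add: lin)
    also have "\<rho> (y [^] j) *\<^sub>v (\<rho> (y [^] k) *\<^sub>v v) = \<rho> (y [^] (j + k)) *\<^sub>v v"
      using v by (simp flip: act nat_pow_mult)
    also have "z ^ (i * r ^ k) \<cdot>\<^sub>v (\<rho> (y [^] (j + k)) *\<^sub>v v) =
        (z ^ (i * r ^ k) * c ^ ((j + k) div m)) \<cdot>\<^sub>v (P *\<^sub>v unit_vec m ((j + k) mod m))"
      using m_pos by (subst y_on) (simp add: smult_smult_assoc P_unit)
    also have "\<dots> = P *\<^sub>v (F j i *\<^sub>v unit_vec m k)"
      using k P by (simp add: F_def monomial_mat_unit_vec mult_mat_vec[of P n m])
    also have "\<dots> = col (P * F j i) k"
      using k P F by (subst col_unit[symmetric, of _ n m])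
        (auto simp: assoc_mult_mat_vec[OF P F])
    finally show "col (\<rho> (word j i) * P) k = col (P * F j i) k" .
  qed (use P in \<open>simp_all add: F_def\<close>)
  have P0: "P *\<^sub>v unit_vec m 0 \<noteq> 0\<^sub>v n" using P_unit[OF m_pos] v by (simp add: \<rho>_one)

  have surj: "(\<lambda>u. P *\<^sub>v u) ` carrier_vec m = carrier_vec n"
  proof -
    have "vec_subspace n ((\<lambda>u. P *\<^sub>v u) ` carrier_vec m)"
      unfolding vec_subspace_iff
    proof (intro conjI ballI allI)
      show "0\<^sub>v n \<in> (\<lambda>u. P *\<^sub>v u) ` carrier_vec m"
        using P by (intro image_eqI[of _ _ "0\<^sub>v m"]) auto
    qed (use P in \<open>auto simp: mult_mat_vec[of P n m, symmetric] mult_add_distrib_mat_vec[of P n m, symmetric]\<close>)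
    moreover have "\<rho> g *\<^sub>v w \<in> (\<lambda>u. P *\<^sub>v u) ` carrier_vec m"
      if g: "g \<in> carrier G" and w: "w \<in> (\<lambda>u. P *\<^sub>v u) ` carrier_vec m" for g w
    proof -
      obtain t where t: "t \<in> carrier_vec m" "w = P *\<^sub>v t" using w by blast
      obtain j i where ji: "g = word j i" using ex_word[OF g] by blast
      have "\<rho> g *\<^sub>v w = (\<rho> (word j i) * P) *\<^sub>v t"
        using P t ji by (simp add: assoc_mult_mat_vec[OF \<rho>_carrier P])
      also have "\<dots> = P *\<^sub>v (F j i *\<^sub>v t)" unfolding inter by (rule assoc_mult_mat_vec[OF P F t(1)])
      finally show ?thesis using mult_mat_vec_carrier[OF F t(1)] by blast
    qed
    moreover have "(\<lambda>u. P *\<^sub>v u) ` carrier_vec m \<noteq> {0\<^sub>v n}"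
      using P0 by (metis image_eqI singletonD unit_vec_carrier)
    ultimately show ?thesis using irrD by blast
  qed
  have ker: "t = 0\<^sub>v m" if t: "t \<in> carrier_vec m" "P *\<^sub>v t = 0\<^sub>v n" for t
  proof -
    let ?N = "{t \<in> carrier_vec m. P *\<^sub>v t = 0\<^sub>v n}"
    have "vec_subspace m ?N"
      using P unfolding vec_subspace_iff
      by (auto simp: mult_mat_vec[of P n m] mult_add_distrib_mat_vec[of P n m])
    moreover have "F j i *\<^sub>v w \<in> ?N" if w: "w \<in> ?N" for j i w
    proof -
      have w: "w \<in> carrier_vec m" "P *\<^sub>v w = 0\<^sub>v n" using w by auto
      have "P *\<^sub>v (F j i *\<^sub>v w) = (\<rho> (word j i) * P) *\<^sub>v w"
        unfolding inter by (rule assoc_mult_mat_vec[OF P F w(1), symmetric])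
      also have "\<dots> = \<rho> (word j i) *\<^sub>v 0\<^sub>v n"
        using w by (simp add: assoc_mult_mat_vec[OF \<rho>_carrier P])
      also have "\<dots> = 0\<^sub>v n" by (intro eq_vecI) (auto simp: \<rho>_carrier[THEN carrier_matD(1)])
      finally show ?thesis using mult_mat_vec_carrier[OF F w(1)] by blast
    qed
    ultimately have "?N = {0\<^sub>v m} \<or> ?N = carrier_vec m"
      unfolding F_def m_def
      by (intro monomial_mat_irreducible[OF _ z K_pos admissible_nonzero[OF adm] orbit_distinct[OF z]]) auto
    moreover have "unit_vec m 0 \<notin> ?N" using P0 by simp
    ultimately have "?N = {0\<^sub>v m}" using unit_vec_carrier[of m 0] by blast
    then show ?thesis using t by blast
  qed

  \<comment> \<open>Preimages of the unit vectors form a right inverse \<open>R\<close>; injectivity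
    of \<open>P\<close> makes it a left inverse too.\<close>
  have "\<forall>b. \<exists>t. b < n \<longrightarrow> t \<in> carrier_vec m \<and> P *\<^sub>v t = unit_vec n b"
    using surj by (metis (no_types, lifting) image_iff unit_vec_carrier)
  then obtain f where f: "\<And>b. b < n \<Longrightarrow> f b \<in> carrier_vec m" "\<And>b. b < n \<Longrightarrow> P *\<^sub>v f b = unit_vec n b"
    by metis
  define R where "R = mat m n (\<lambda>(a, b). f b $ a)"
  have R: "R \<in> carrier_mat m n" by (simp add: R_def)
  have col_R: "col R b = f b" if "b < n" for b using that f(1)[OF that] by (auto simp: R_def)
  have PR: "P * R = 1\<^sub>m n"
  proof (rule mat_col_eqI)
    fix b assume "b < dim_col (1\<^sub>m n :: complex mat)"
    then show "col (P * R) b = col (1\<^sub>m n) b"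
      using col_mult2[OF P R, of b] f(2)[of b] by (simp add: col_R)
  qed (use P R in simp_all)
  have RP: "R * P = 1\<^sub>m m"
  proof (rule mat_col_eqI)
    fix k assume "k < dim_col (1\<^sub>m m :: complex mat)"
    then have k: "k < m" by simp
    let ?t = "R *\<^sub>v (P *\<^sub>v unit_vec m k)"
    have t: "?t \<in> carrier_vec m" using P R by simp
    have "P *\<^sub>v ?t = (P * R) *\<^sub>v (P *\<^sub>v unit_vec m k)" using P R by simp
    also have "\<dots> = P *\<^sub>v unit_vec m k" unfolding PR using P by simp
    finally have "P *\<^sub>v (?t - unit_vec m k) = 0\<^sub>v n"
      using P t by (simp add: mult_minus_distrib_mat_vec[of P n m])
    then have "?t - unit_vec m k = 0\<^sub>v m" using t by (intro ker) auto
    then have "?t = unit_vec m k"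
      using minus_vec_eq_zeroD[OF t unit_vec_carrier] by simp
    then show "col (R * P) k = col (1\<^sub>m m) k"
      using k P R by (subst col_unit[symmetric, of _ m m]) auto
  qed (use P R in simp_all)

  have "character_of G \<rho> = monomial_char z c"
  proof (rule ext)
    fix g
    show "character_of G \<rho> g = monomial_char z c g"
    proof (cases "g \<in> carrier G")
      case True
      then obtain j i where ji: "g = word j i" using ex_word by blast
      have "mat_trace (\<rho> g) = mat_trace (F j i)"
        using mat_trace_intertwine[OF \<rho>_carrier F P R PR RP] inter ji True by blast
      then show ?thesis
        by (simp add: monomial_char_def character_of_def True)
          (simp add: ji monomial_rep_word[OF adm] F_def m_def)
    qed (simp add: monomial_char_def character_of_def)
  qed
  then show ?thesis using adm by blast
qed

lemma Irr_eq: "Irr G = {monomial_char z c | z c. admissible z c}"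
proof
  show "Irr G \<subseteq> {monomial_char z c | z c. admissible z c}"
    unfolding Irr_def using irreducible_character_monomial by blast
  show "{monomial_char z c | z c. admissible z c} \<subseteq> Irr G"
    using monomial_char_in_Irr by blast
qed

end

section \<open>Kernels, codegrees and numbers of characters\<close>

text \<open>Equality case of the triangle inequality: real parts are at most 1 and add up to
  \<open>m\<close>, so each is 1.\<close>

lemma sum_unit_norm_eq_card:
  fixes a :: "nat \<Rightarrow> complex"
  assumes norm: "\<And>k. k < m \<Longrightarrow> norm (a k) = 1" and sum: "(\<Sum>k<m. a k) = of_nat m" and "k < m"
  shows "a k = 1"
proof -
  have "(\<Sum>k<m. 1 - Re (a k)) = 0"
    using arg_cong[OF sum, of Re] by (simp add: sum_subtractf)
  moreover have le: "0 \<le> 1 - Re (a k)" if "k < m" for k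
    using complex_Re_le_cmod[of "a k"] norm[OF that] by simp
  ultimately have Re: "Re (a k) = 1"
    using sum_nonneg_eq_0_iff[of "{..<m}" "\<lambda>k. 1 - Re (a k)"] \<open>k < m\<close> by simp
  then have "Im (a k) = 0"
    using norm[OF \<open>k < m\<close>] cmod_power2[of "a k"] by simp
  with Re show ?thesis by (simp add: complex_eq_iff)
qed

text \<open>Lagrange's theorem in the quotient \<open>G Mod H\<close>.\<close>

lemma (in normal) pow_card_rcosets_in:
  assumes "finite (carrier G)" and g: "g \<in> carrier G"
  shows "g [^] card (rcosets H) \<in> H"
proof -
  interpret Q: group "G Mod H" by (rule factorgroup_is_group)
  interpret h: group_hom G "G Mod H" "\<lambda>a. H #> a"
    by unfold_locales (rule r_coset_hom_Mod)
  have "H #> g [^] card (rcosets H) = (H #> g) [^]\<^bsub>G Mod H\<^esub> Coset.order (G Mod H)"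
    using h.hom_nat_pow[OF g] by (simp add: Coset.order_def FactGroup_def)
  also have "\<dots> = H"
    using Q.pow_order_eq_1[of "H #> g"] h.hom_closed[OF g] by (simp add: FactGroup_def)
  finally show ?thesis
    using coset_join1 g subgroup_axioms by blast
qed

text \<open>First isomorphism theorem for \<open>h\<close> viewed as a surjection onto its
  image.\<close>

lemma (in group_hom) card_rcosets_kernel:
  "card (rcosets (kernel G H h)) = card (h ` carrier G)"
proof -
  let ?I = "H\<lparr>carrier := h ` carrier G\<rparr>"
  interpret I: group ?I using img_is_subgroup by (rule subgroup.subgroup_is_group) simp
  interpret hI: group_hom G ?I h
    by unfold_locales (auto simp: hom_def)
  have k: "kernel G ?I h = kernel G H h" by (simp add: kernel_def)
  have "(\<lambda>X. the_elem (h ` X)) \<in> iso (G Mod kernel G ?I h) ?I"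
    by (rule hI.FactGroup_iso_set) simp
  then have "bij_betw (\<lambda>X. the_elem (h ` X)) (carrier (G Mod kernel G H h)) (h ` carrier G)"
    by (simp add: iso_def k)
  from bij_betw_same_card[OF this] show ?thesis by (simp add: FactGroup_def)
qed

context metacyclic_presentation
begin

lemma finite_roots: "n > 0 \<Longrightarrow> finite {z::complex. z ^ n = a}"
  by (cases "a = 0") (auto intro: card_ge_0_finite simp: card_nth_roots)

lemma Fix_iff: "z ^ K = 1 \<Longrightarrow> orbit_size z = 1 \<longleftrightarrow> z ^ r = z"
  using orbit_size_dvd_iff[of z 1] by simp

definition ker_index :: "complex \<Rightarrow> complex \<Rightarrow> nat" where
  "ker_index z c = card (rcosets (character_kernel G (monomial_char z c)))"

context
  fixes z c :: complex
  assumes adm: "admissible z c"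
begin

lemma admissible_norm: "norm z = 1" "norm c = 1"
proof -
  show "norm z = 1" using power_eq_1_iff[OF admissible_root[OF adm]] K_pos by simp
  have "c ^ ((M div orbit_size z) * K) = 1"
    using adm admissible_root[OF adm] by (simp add: admissible_def power_mult) (metis mult.commute power_mult power_one)
  moreover have "(M div orbit_size z) * K > 0"
    using orbit_size_dvd_M[OF admissible_root[OF adm]] orbit_size_pos[OF admissible_root[OF adm]] M_pos K_pos
    by (simp add: div_greater_zero_iff dvd_imp_le)
  ultimately show "norm c = 1" using power_eq_1_iff by fastforce
qed

text \<open>The trace is either 0 or a sum of \<open>m\<close> numbers of modulus 1; it equals
  \<open>m\<close> only if all of them are 1, that is, if the matrix is the identity.\<close>

lemma character_kernel_monomial_char:
  "character_kernel G (monomial_char z c) =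
    {g \<in> carrier G. monomial_rep z c g = 1\<^sub>m (orbit_size z)}"
proof -
  let ?m = "orbit_size z"
  have "monomial_rep z c g = 1\<^sub>m ?m" if g: "g \<in> carrier G" "monomial_char z c g = of_nat ?m" for g
  proof -
    obtain j i where ji: "g = word j i" using ex_word g by blast
    have "(if ?m dvd j then c ^ (j div ?m) * (\<Sum>k<?m. z ^ (i * r ^ k)) else 0) = of_nat ?m"
      using g(2) unfolding ji monomial_char_word[OF adm] .
    then have j: "?m dvd j" and s: "(\<Sum>k<?m. c ^ (j div ?m) * z ^ (i * r ^ k)) = of_nat ?m"
      using orbit_size_pos[OF admissible_root[OF adm]] by (auto simp: sum_distrib_left split: if_splits)
    have one: "c ^ (j div ?m) * z ^ (i * r ^ k) = 1" if "k < ?m" for k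
      by (rule sum_unit_norm_eq_card[OF _ s that]) (simp add: norm_mult norm_power admissible_norm)
    have "(j + k) mod ?m = k" "(j + k) div ?m = j div ?m" if "k < ?m" for k
      using j that by (auto elim!: dvdE)
    then show ?thesis
      unfolding ji monomial_rep_word[OF adm]
      by (intro eq_matI) (auto simp: monomial_mat_def one mult.commute)
  qed
  moreover have "monomial_char z c g = of_nat ?m"
    if "g \<in> carrier G" "monomial_rep z c g = 1\<^sub>m ?m" for g
    using that by (simp add: monomial_char_def character_of_def mat_trace_one)
  ultimately show ?thesis
    by (auto simp: character_kernel_def monomial_char_one[OF adm])
qed

lemma monomial_rep_group_hom:
  "group_hom G (units_of (ring_mat TYPE(complex) (orbit_size z) ())) (monomial_rep z c)"
proof -
  interpret R: Ring.ring "ring_mat TYPE(complex) (orbit_size z) ()" by (rule ring_mat)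
  interpret U: group "units_of (ring_mat TYPE(complex) (orbit_size z) ())" by (rule R.units_group)
  show ?thesis
    by unfold_locales (use monomial_rep_representation[OF adm] in \<open>simp add: representations_def\<close>)
qed

lemma kernel_monomial_rep:
  "kernel G (units_of (ring_mat TYPE(complex) (orbit_size z) ())) (monomial_rep z c) =
    character_kernel G (monomial_char z c)"
  by (simp add: kernel_def character_kernel_monomial_char units_of_def ring_mat_simps)


lemma character_kernel_normal: "character_kernel G (monomial_char z c) \<lhd> G"
  using group_hom.normal_kernel[OF monomial_rep_group_hom] unfolding kernel_monomial_rep .

lemma codegree_monomial_char:
  "codegree G (monomial_char z c) = of_nat (ker_index z c) / of_nat (orbit_size z)"
  by (simp add: codegree_def ker_index_def monomial_char_one[OF adm])

lemma ker_index_mult_card: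
  "ker_index z c * card (character_kernel G (monomial_char z c)) = M * K"
  unfolding ker_index_def
  using lagrange[OF normal_imp_subgroup[OF character_kernel_normal]] order_eq by simp

lemma word_in_kernel_iff:
  "word j i \<in> character_kernel G (monomial_char z c) \<longleftrightarrow>
    monomial_mat r (orbit_size z) z c j i = 1\<^sub>m (orbit_size z)"
  by (simp add: character_kernel_monomial_char monomial_rep_word[OF adm])

text \<open>The power of \<open>x\<close> with this exponent lies in the kernel of the character;
  compare the top left matrix entries. This ties the order of \<open>z\<close> to the
  codegree.\<close>

lemma z_pow_ker_index: "z ^ ker_index z c = 1"
proof -
  have "word 0 (ker_index z c) \<in> character_kernel G (monomial_char z c)"
    using normal.pow_card_rcosets_in[OF character_kernel_normal finite_carrier x_closed]
    by (simp add: ker_index_def word_def)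
  from arg_cong[OF this[unfolded word_in_kernel_iff], of "\<lambda>A. A $$ (0, 0)"]
  show ?thesis using orbit_size_pos[OF admissible_root[OF adm]] by (simp add: monomial_mat_def)
qed

lemma c_pow_ker_index:
  assumes "orbit_size z = 1"
  shows "c ^ ker_index z c = 1"
proof -
  have "word (ker_index z c) 0 \<in> character_kernel G (monomial_char z c)"
    using normal.pow_card_rcosets_in[OF character_kernel_normal finite_carrier y_closed]
    by (simp add: ker_index_def word_def)
  from arg_cong[OF this[unfolded word_in_kernel_iff], of "\<lambda>A. A $$ (0, 0)"]
  show ?thesis using assms by (simp add: monomial_mat_def)
qed

text \<open>In degree one the index of the kernel is the order of the image, and the trace
  identifies that image with the group generated by \<open>c\<close> and \<open>z\<close>.\<close>

lemma ker_index_linear: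
  assumes "orbit_size z = 1"
  shows "ker_index z c = card {c ^ j * z ^ i | j i. True}"
proof -
  have "ker_index z c = card (monomial_rep z c ` carrier G)"
    unfolding ker_index_def
    using group_hom.card_rcosets_kernel[OF monomial_rep_group_hom]
    unfolding kernel_monomial_rep .
  also have "\<dots> = card (mat_trace ` monomial_rep z c ` carrier G)"
  proof (rule card_image[symmetric], rule inj_onI)
    fix A B assume "A \<in> monomial_rep z c ` carrier G" "B \<in> monomial_rep z c ` carrier G"
    then have AB: "A \<in> carrier_mat 1 1" "B \<in> carrier_mat 1 1"
      using monomial_rep_carrier[OF adm] assms by auto
    assume "mat_trace A = mat_trace B"
    then show "A = B" using AB by (intro eq_matI) (auto simp: mat_trace_def)
  qed
  also have "mat_trace ` monomial_rep z c ` carrier G = {c ^ j * z ^ i | j i. True}"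
  proof -
    have eq: "mat_trace (monomial_rep z c (word j i)) = c ^ j * z ^ i" for j i
      by (simp add: monomial_rep_word[OF adm] mat_trace_monomial_mat assms)
    show ?thesis
    proof (intro equalityI subsetI)
      fix w assume "w \<in> mat_trace ` monomial_rep z c ` carrier G"
      then obtain g where g: "g \<in> carrier G" "w = mat_trace (monomial_rep z c g)" by blast
      obtain j i where "g = word j i" using ex_word[OF g(1)] by blast
      then show "w \<in> {c ^ j * z ^ i | j i. True}" using g eq by auto
    next
      fix w assume "w \<in> {c ^ j * z ^ i | j i. True}"
      then obtain j i where "w = mat_trace (monomial_rep z c (word j i))" using eq by auto
      then show "w \<in> mat_trace ` monomial_rep z c ` carrier G" by simp
    qed
  qed
  finally show ?thesis .
qed

lemma ker_index_linear_le:
  assumes o: "orbit_size z = 1" and e: "z ^ e = 1" "c ^ e = 1" "e > 0"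
  shows "ker_index z c \<le> e"
proof -
  have "{c ^ j * z ^ i | j i. True} \<subseteq> {w. w ^ e = 1}"
  proof
    fix w assume "w \<in> {c ^ j * z ^ i | j i. True}"
    then obtain j i where w: "w = c ^ j * z ^ i" by blast
    have "w ^ e = (c ^ e) ^ j * (z ^ e) ^ i"
      by (simp add: w power_mult_distrib mult.commute flip: power_mult)
    then show "w \<in> {w. w ^ e = 1}" using e by simp
  qed
  then have "card {c ^ j * z ^ i | j i. True} \<le> card {w::complex. w ^ e = 1}"
    by (rule card_mono[OF finite_roots[OF e(3)]])
  then show ?thesis using ker_index_linear[OF o] card_roots_unity_eq[OF e(3)] by simp
qed

text \<open>Moving \<open>z\<close> along its orbit amounts to starting the basis at another
  translate of the eigenvector; on characters this only shifts the sum over the orbit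
  cyclically.\<close>

lemma admissible_orbit:
  "admissible (z ^ (r ^ k)) c" "orbit_size (z ^ (r ^ k)) = orbit_size z"
  "monomial_char (z ^ (r ^ k)) c = monomial_char z c"
proof -
  have "(z ^ (r ^ k)) ^ (r ^ a) = z ^ (r ^ k) \<longleftrightarrow> z ^ (r ^ a) = z" for a
  proof
    assume "(z ^ (r ^ k)) ^ (r ^ a) = z ^ (r ^ k)"
    \<comment> \<open>A further \<open>(M - 1) * k\<close> iterations complete the shift to
      \<open>M * k\<close>, a multiple of the orbit length, and so undo it.\<close>
    then have "((z ^ (r ^ k)) ^ (r ^ a)) ^ (r ^ ((M - 1) * k)) = (z ^ (r ^ k)) ^ (r ^ ((M - 1) * k))"
      by simp
    then have e: "z ^ (r ^ (k + a + (M - 1) * k)) = z ^ (r ^ (k + (M - 1) * k))"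
      by (simp flip: power_mult power_add)
    have Mk: "k + (M - 1) * k = M * k" using M_pos by (cases M) simp_all
    have "k + a + (M - 1) * k = M * k + a" using Mk by simp
    then have "z ^ (r ^ (M * k + a)) = z ^ (r ^ (M * k))" using e unfolding Mk by metis
    moreover have zM: "z ^ (r ^ (M * k)) = z"
      using orbit_size_dvd_iff[OF admissible_root[OF adm], of "M * k"] orbit_size_dvd_M[OF admissible_root[OF adm]] by simp
    ultimately show "z ^ (r ^ a) = z" by (simp add: power_add power_mult)
  next
    assume "z ^ (r ^ a) = z"
    then show "(z ^ (r ^ k)) ^ (r ^ a) = z ^ (r ^ k)"
      by (metis mult.commute power_mult)
  qed
  then show o: "orbit_size (z ^ (r ^ k)) = orbit_size z" by (simp add: orbit_size_def)
  have "(z ^ (r ^ k)) ^ K = 1" using admissible_root[OF adm] by (metis mult.commute power_mult power_one)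
  moreover have "(z ^ (r ^ k)) ^ s = z ^ s" using z_pow_s[OF admissible_root[OF adm], of k] by (metis mult.commute power_mult)
  ultimately show adm': "admissible (z ^ (r ^ k)) c"
    using adm o by (simp add: admissible_def)
  show "monomial_char (z ^ (r ^ k)) c = monomial_char z c"
  proof (rule ext)
    fix g
    show "monomial_char (z ^ (r ^ k)) c g = monomial_char z c g"
    proof (cases "g \<in> carrier G")
      case True
      then obtain j i where ji: "g = word j i" using ex_word by blast
      have shift: "(\<Sum>l<orbit_size z. z ^ (r ^ (k + l) * i)) = (\<Sum>l<orbit_size z. z ^ (r ^ l * i))"
      proof (induction k)
        case (Suc k)
        let ?f = "\<lambda>l. z ^ (r ^ (k + l) * i)"
        have "?f (orbit_size z) = ?f 0"
          using power_orbit_mod[OF orbit_size_fix[OF admissible_root[OF adm]], of "k + orbit_size z"]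
            power_orbit_mod[OF orbit_size_fix[OF admissible_root[OF adm]], of k] by (simp add: power_mult)
        then have "(\<Sum>l<orbit_size z. ?f (Suc l)) = (\<Sum>l<orbit_size z. ?f l)"
          using sum.lessThan_Suc_shift[of ?f "orbit_size z"] by simp
        then show ?case using Suc by simp
      qed simp
      have "(z ^ (r ^ k)) ^ (i * r ^ l) = z ^ (r ^ (k + l) * i)" for l
        by (simp add: power_add mult_ac flip: power_mult)
      then show ?thesis
        unfolding ji monomial_char_word[OF adm] monomial_char_word[OF adm'] o
        using shift by (simp add: mult.commute)
    qed (simp add: monomial_char_def character_of_def)
  qed
qed

end

section \<open>Counting characters\<close>

lemma finite_admissible: "finite {(z, c). admissible z c}"
proof -
  have "{(z, c). admissible z c} \<subseteq> (SIGMA z:{z. z ^ K = 1}. {c. c ^ (M div orbit_size z) = z ^ s})"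
    by (auto simp: admissible_def)
  moreover have "finite {c::complex. c ^ (M div orbit_size z) = z ^ s}" if "z ^ K = 1" for z
    using orbit_size_dvd_M[OF that] orbit_size_pos[OF that] M_pos
    by (intro finite_roots) (simp add: div_greater_zero_iff dvd_imp_le)
  ultimately show ?thesis
    by (intro finite_subset[OF _ finite_SigmaI[OF finite_roots[OF K_pos, of 1]]]) auto
qed

lemma Irr_image: "Irr G = (\<lambda>(z, c). monomial_char z c) ` {(z, c). admissible z c}"
  by (auto simp: Irr_eq)

lemma finite_Irr: "finite (Irr G)"
  unfolding Irr_image by (intro finite_imageI finite_admissible)

text \<open>The nonzero number \<open>z ^ s\<close> has exactly \<open>M div m\<close> roots
  \<open>c\<close> of order \<open>M div m\<close>.\<close>

lemma card_admissible:
  assumes Z: "\<And>z. z \<in> Z \<Longrightarrow> z ^ K = 1 \<and> orbit_size z = m"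
  shows "card {(z, c). z \<in> Z \<and> admissible z c} = card Z * (M div m)"
proof -
  have "{(z, c). z \<in> Z \<and> admissible z c} = (SIGMA z:Z. {c. c ^ (M div m) = z ^ s})"
    using Z by (auto simp: admissible_def)
  moreover have "card {c::complex. c ^ (M div m) = z ^ s} = M div m" if "z \<in> Z" for z
    using Z[OF that] orbit_size_dvd_M[of z] orbit_size_pos[of z] M_pos z_nonzero[of z]
    by (intro card_nth_roots) (auto simp: div_greater_zero_iff dvd_imp_le)
  moreover have "finite Z" by (rule finite_subset[OF _ finite_roots[OF K_pos, of 1]]) (use Z in auto)
  moreover have "finite {c::complex. c ^ (M div m) = z ^ s}" if "z \<in> Z" for z
    using Z[OF that] orbit_size_dvd_M[of z] orbit_size_pos[of z] M_pos
    by (intro finite_roots) (auto simp: div_greater_zero_iff dvd_imp_le)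
  ultimately show ?thesis by simp
qed

text \<open>Each character arises from at least the \<open>m\<close> distinct pairs
  \<open>(z ^ (r ^ k), c)\<close> with \<open>k < m\<close>; then count pairs.\<close>

lemma card_monomial_chars_le:
  assumes Z: "\<And>z. z \<in> Z \<Longrightarrow> z ^ K = 1 \<and> orbit_size z = m"
    and closed: "\<And>z k. z \<in> Z \<Longrightarrow> z ^ (r ^ k) \<in> Z"
  shows "m * card {monomial_char z c | z c. z \<in> Z \<and> admissible z c} \<le> card Z * (M div m)"
proof -
  let ?S = "{(z, c). z \<in> Z \<and> admissible z c}" and ?f = "\<lambda>(z, c). monomial_char z c"
  have fin: "finite ?S" by (rule finite_subset[OF _ finite_admissible]) auto
  have im: "{monomial_char z c | z c. z \<in> Z \<and> admissible z c} = ?f ` ?S" by auto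
  have "m \<le> card {p \<in> ?S. ?f p = \<chi>}" if \<chi>: "\<chi> \<in> ?f ` ?S" for \<chi>
  proof -
    obtain z c where zc: "z \<in> Z" "admissible z c" "\<chi> = monomial_char z c" using \<chi> by auto
    have "m = card ((\<lambda>k. (z ^ (r ^ k), c)) ` {..<m})"
      using orbit_distinct[of z] Z[OF zc(1)] by (subst card_image) (auto simp: inj_on_def)
    also have "\<dots> \<le> card {p \<in> ?S. ?f p = \<chi>}"
      using zc closed admissible_orbit[OF zc(2)] fin by (intro card_mono) auto
    finally show ?thesis .
  qed
  then have "(\<Sum>\<chi>\<in>?f ` ?S. m) \<le> (\<Sum>\<chi>\<in>?f ` ?S. card {p \<in> ?S. ?f p = \<chi>})"
    by (intro sum_mono) blast
  also have "\<dots> = card ?S"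
    using sum.image_gen[OF fin, of "\<lambda>_. 1::nat" ?f] by simp
  also have "card ?S = card Z * (M div m)" by (rule card_admissible[OF Z])
  finally show ?thesis unfolding im by (simp add: mult.commute)
qed

text \<open>\<open>z\<close> and \<open>c\<close> are recovered as the values at \<open>x\<close>
  and \<open>y\<close>.\<close>

lemma linear_char_inj: "inj_on (\<lambda>(z, c). monomial_char z c) {(z, c). orbit_size z = 1 \<and> admissible z c}"
proof -
  have "monomial_char z c (word 0 1) = z" "monomial_char z c (word 1 0) = c"
    if "orbit_size z = 1" "admissible z c" for z c
    by (simp_all add: monomial_char_word[OF that(2)] that(1))
  then show ?thesis by (intro inj_onI) (clarify, metis)
qed

definition linear_chars :: "('a \<Rightarrow> complex) set" where
  "linear_chars = {monomial_char z c | z c. orbit_size z = 1 \<and> admissible z c}"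

lemma card_linear_chars: "card linear_chars = card {z::complex. z ^ K = 1 \<and> z ^ r = z} * M"
proof -
  let ?Z = "{z::complex. z ^ K = 1 \<and> z ^ r = z}"
  have S: "{(z, c). orbit_size z = 1 \<and> admissible z c} = {(z, c). z \<in> ?Z \<and> admissible z c}"
    using Fix_iff by (auto simp: admissible_def)
  have "linear_chars = (\<lambda>(z, c). monomial_char z c) ` {(z, c). orbit_size z = 1 \<and> admissible z c}"
    by (auto simp: linear_chars_def)
  then have "card linear_chars = card {(z, c). z \<in> ?Z \<and> admissible z c}"
    using card_image[OF linear_char_inj] S by simp
  also have "\<dots> = card ?Z * (M div 1)"
    by (rule card_admissible) (use Fix_iff in auto)
  finally show ?thesis by simp
qed

lemma linear_chars_subset: "linear_chars \<subseteq> Irr G"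
  by (auto simp: linear_chars_def Irr_eq)

lemma ex_admissible:
  assumes "z ^ K = 1"
  shows "\<exists>c. admissible z c"
proof -
  have "M div orbit_size z > 0"
    using orbit_size_dvd_M[OF assms] orbit_size_pos[OF assms] M_pos
    by (simp add: div_greater_zero_iff dvd_imp_le)
  then have "card {c::complex. c ^ (M div orbit_size z) = z ^ s} > 0"
    using z_nonzero[OF assms] by (subst card_nth_roots) auto
  then obtain c where "c ^ (M div orbit_size z) = z ^ s" by (auto simp: card_gt_0_iff)
  then show ?thesis using assms by (auto simp: admissible_def)
qed

lemma monomial_char_linear_iff:
  assumes adm: "admissible z c"
  shows "monomial_char z c \<in> linear_chars \<longleftrightarrow> orbit_size z = 1"
proof
  assume "monomial_char z c \<in> linear_chars"
  then obtain z' c' where "orbit_size z' = 1" "admissible z' c'" "monomial_char z c = monomial_char z' c'"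
    by (auto simp: linear_chars_def)
  then have "of_nat (orbit_size z) = (of_nat 1 :: complex)"
    using monomial_char_one[OF adm] monomial_char_one by metis
  then show "orbit_size z = 1" by (simp only: of_nat_eq_iff)
qed (use adm in \<open>auto simp: linear_chars_def\<close>)

text \<open>A primitive \<open>K\<close>-th root of unity is fixed by the \<open>r\<close>-th power
  only if \<open>r\<close> is 1 modulo \<open>K\<close>, so here its orbit has more than one
  point.\<close>

lemma nonlinear_char_exists:
  assumes "\<not> [r = 1] (mod K)"
  shows "\<exists>\<chi>\<in>Irr G. \<chi> \<notin> linear_chars"
proof -
  obtain z :: complex where z: "\<And>k. z ^ k = 1 \<longleftrightarrow> K dvd k"
    using exists_primitive_root[OF K_pos] by blast
  have zK: "z ^ K = 1" by (simp add: z)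
  have "z ^ r \<noteq> z"
  proof
    assume e: "z ^ r = z"
    have "z \<noteq> 0" using z_nonzero[OF zK] .
    show False
    proof (cases r)
      case 0
      then have "z ^ 1 = 1" using e by simp
      then have "K = 1" by (simp only: z) simp
      then show False using assms by simp
    next
      case (Suc n)
      then have "z ^ n = 1" using e \<open>z \<noteq> 0\<close> by simp
      then have "K dvd n" by (simp only: z)
      then have "[r = 1] (mod K)" using cong_altdef_nat[of 1 r K] Suc by simp
      then show False using assms by simp
    qed
  qed
  then have o: "orbit_size z \<noteq> 1" using Fix_iff[OF zK] by simp
  obtain c where adm: "admissible z c" using ex_admissible[OF zK] by blast
  then have "monomial_char z c \<notin> linear_chars" using o monomial_char_linear_iff by simp
  then show ?thesis using monomial_char_in_Irr[OF adm] by blast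
qed

end

section \<open>Orbits of roots of unity\<close>

lemma one_plus_mult_power_expansion:
  fixes p u :: int
  shows "\<exists>v. (1 + p * u) ^ l = 1 + int l * (p * u) + p ^ 2 * v"
proof (induction l)
  case (Suc l)
  then obtain v where v: "(1 + p * u) ^ l = 1 + int l * (p * u) + p ^ 2 * v" by blast
  have "(1 + p * u) ^ Suc l = 1 + int (Suc l) * (p * u) + p ^ 2 * (v * (1 + p * u) + int l * u ^ 2)"
    unfolding power_Suc v by (simp add: algebra_simps power2_eq_square)
  then show ?case by blast
qed auto

text \<open>For odd \<open>p\<close> write \<open>R = 1 + p u\<close>: modulo \<open>p ^ 2\<close>
  the sum is \<open>p\<close> plus \<open>p u\<close> times \<open>p (p - 1) / 2\<close>, hence just
  \<open>p\<close>. For \<open>p = 2\<close> it is \<open>1 + R\<close>, which is 2 modulo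
  4.\<close>

lemma prime_square_not_dvd_geometric_sum:
  fixes p R :: nat
  assumes p: "prime p" and R: "[R = 1] (mod p)" and R4: "p = 2 \<Longrightarrow> [R = 1] (mod 4)"
  shows "\<not> p ^ 2 dvd (\<Sum>l<p. R ^ l)" "p dvd (\<Sum>l<p. R ^ l)"
proof -
  have "[(\<Sum>l<p. R ^ l) = (\<Sum>l<p. 1 ^ l)] (mod p)"
    by (intro cong_sum cong_pow R)
  then show "p dvd (\<Sum>l<p. R ^ l)" by (simp add: cong_dvd_iff)
  show "\<not> p ^ 2 dvd (\<Sum>l<p. R ^ l)"
  proof (cases "p = 2")
    case True
    have "R mod 4 = 1" using R4[OF True] by (simp add: cong_def)
    then have "(1 + R) mod 4 = 2" by presburger
    moreover have "(\<Sum>l<2. R ^ l) = 1 + R" by (simp add: numeral_2_eq_2)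
    ultimately show ?thesis using True by (simp add: dvd_eq_mod_eq_0)
  next
    case False
    have "int p dvd int R - 1" using R by (metis cong_iff_dvd_diff cong_int_iff of_nat_1)
    then obtain u where u: "int R = 1 + int p * u" by (auto simp: dvd_def algebra_simps)
    have "\<forall>l. \<exists>v. int R ^ l = 1 + int l * (int p * u) + int p ^ 2 * v"
      unfolding u using one_plus_mult_power_expansion by blast
    then obtain v where v: "\<And>l. int R ^ l = 1 + int l * (int p * u) + int p ^ 2 * v l" by metis
    have odd: "odd p" using False p by (simp add: prime_odd_nat prime_ge_2_nat order_less_le)
    then obtain q where q: "p = 2 * q + 1" by (elim oddE)
    have gauss: "(\<Sum>l<p. int l) = int p * int q"
    proof -
      have "2 * (\<Sum>l<n. int l) = int n * (int n - 1)" for n :: nat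
        by (induction n) (simp_all add: algebra_simps)
      from this[of p] show ?thesis using q by (simp add: algebra_simps)
    qed
    have "int (\<Sum>l<p. R ^ l) = int p + (\<Sum>l<p. int l) * (int p * u) + int p ^ 2 * (\<Sum>l<p. v l)"
      by (simp add: v sum.distrib sum_distrib_left sum_distrib_right)
    also have "\<dots> = int p + int p ^ 2 * (int q * u + (\<Sum>l<p. v l))"
      unfolding gauss by (simp add: power2_eq_square algebra_simps)
    finally have e: "int (\<Sum>l<p. R ^ l) = int p + int p ^ 2 * (int q * u + (\<Sum>l<p. v l))" .
    show ?thesis
    proof
      assume "p ^ 2 dvd (\<Sum>l<p. R ^ l)"
      then have "int p ^ 2 dvd int (\<Sum>l<p. R ^ l)" by (metis of_nat_dvd_iff of_nat_power)
      then have "int p ^ 2 dvd int p" unfolding e by (simp add: dvd_add_left_iff)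
      then have "p ^ 2 dvd p" by (metis of_nat_dvd_iff of_nat_power)
      then have "p ^ 2 \<le> p" using prime_gt_0_nat[OF p] by (intro dvd_imp_le)
      then show False using prime_gt_1_nat[OF p] by (simp add: power2_eq_square)
    qed
  qed
qed

text \<open>Cut the range of exponents into \<open>b\<close> blocks of length
  \<open>a\<close>.\<close>

lemma geometric_sum_mult:
  fixes r :: "'a::comm_semiring_1"
  shows "(\<Sum>k<a * b. r ^ k) = (\<Sum>k<a. r ^ k) * (\<Sum>l<b. (r ^ a) ^ l)"
proof (induction b)
  case (Suc b)
  have split: "(\<Sum>k<m + n. f k) = (\<Sum>k<m. f k) + (\<Sum>k<n. f (m + k))"
    for m n and f :: "nat \<Rightarrow> 'a"
    by (induction n) (simp_all add: add.assoc)
  have "(\<Sum>k<a * Suc b. r ^ k) = (\<Sum>k<a * b. r ^ k) + (\<Sum>k<a. r ^ (a * b + k))"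
    using split[of _ "a * b" a] by (simp add: add.commute)
  also have "(\<Sum>k<a. r ^ (a * b + k)) = (\<Sum>k<a. r ^ k) * (r ^ a) ^ b"
    by (simp add: sum_distrib_left sum_distrib_right power_add power_mult mult.commute)
  finally show ?case using Suc by (simp add: algebra_simps)
qed simp

text \<open>Lifting the exponent: passing from \<open>i\<close> to \<open>Suc i\<close> multiplies
  the sum by one of length \<open>p\<close> with ratio \<open>r ^ (p ^ i)\<close>, which contributes
  exactly one factor \<open>p\<close>.\<close>

lemma prime_power_not_dvd_geometric_sum:
  fixes p r :: nat
  assumes p: "prime p" and r: "[r = 1] (mod p)" and r4: "p = 2 \<Longrightarrow> [r = 1] (mod 4)"
  shows "\<not> p ^ Suc i dvd (\<Sum>k<p ^ i. r ^ k)"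
proof (induction i)
  case 0
  then show ?case using prime_gt_1_nat[OF p] by simp
next
  case (Suc i)
  let ?R = "r ^ (p ^ i)"
  have R: "[?R = 1] (mod p)" "p = 2 \<Longrightarrow> [?R = 1] (mod 4)"
    using cong_pow[OF r, of "p ^ i"] cong_pow[OF r4, of "p ^ i"] by simp_all
  have "p dvd (\<Sum>l<p. ?R ^ l)"
    by (rule prime_square_not_dvd_geometric_sum(2)[OF p]) (use R in auto)
  then obtain b where b: "(\<Sum>l<p. ?R ^ l) = p * b" by (elim dvdE)
  have "\<not> p dvd b"
    using prime_square_not_dvd_geometric_sum(1)[OF p R] b by (auto simp: power2_eq_square)
  then have cop: "coprime (p ^ Suc i) b" using p by (simp add: prime_imp_coprime)
  show ?case
  proof
    assume "p ^ Suc (Suc i) dvd (\<Sum>k<p ^ Suc i. r ^ k)"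
    then have "p * p ^ Suc i dvd p * ((\<Sum>k<p ^ i. r ^ k) * b)"
      using geometric_sum_mult[of r "p ^ i" p] b by (simp add: mult_ac)
    then have "p ^ Suc i dvd (\<Sum>k<p ^ i. r ^ k) * b"
      using prime_gt_0_nat[OF p] by (simp only: nat_mult_dvd_cancel_disj) auto
    then have "p ^ Suc i dvd (\<Sum>k<p ^ i. r ^ k)"
      using cop by (simp add: coprime_dvd_mult_left_iff)
    then show False using Suc.IH by simp
  qed
qed

lemma power_gcd_eq_one:
  fixes w :: "'a::field"
  assumes "w ^ a = 1" "w ^ b = 1"
  shows "w ^ gcd a b = 1"
proof (cases "a = 0")
  case False
  then obtain k l where "a * k = b * l + gcd a b" using bezout_nat by blast
  then have "w ^ (a * k) = w ^ (b * l) * w ^ gcd a b" by (simp add: power_add)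
  then show ?thesis by (simp add: power_mult assms)
qed (use assms in simp)

text \<open>Writing \<open>r ^ p ^ i - 1\<close> as \<open>r - 1\<close> times a geometric sum that \<open>p\<close> divides exactly
  \<open>i\<close> times shows that only \<open>p ^ i\<close>-th roots of fixed points have an orbit of length \<open>p ^ i\<close>.\<close>

lemma power_orbit_size_fixed:
  fixes z :: complex and p r :: nat
  assumes p: "prime p" and r: "[r = 1] (mod p)" and r4: "p = 2 \<Longrightarrow> [r = 1] (mod 4)"
    and z: "z ^ (p ^ a) = 1" and fix_z: "z ^ (r ^ (p ^ i)) = z"
  shows "(z ^ (p ^ i)) ^ r = z ^ (p ^ i)"
proof -
  have "r > 0" using r prime_gt_1_nat[OF p] by (auto intro!: gr0I simp: cong_def)
  then obtain q where q: "r = Suc q" by (cases r) auto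
  let ?S = "\<Sum>k<p ^ i. r ^ k"
  have z0: "z \<noteq> 0" using z prime_gt_0_nat[OF p] by (metis power_0_left zero_neq_one power_eq_0_iff)
  \<comment> \<open>Since \<open>q = r - 1\<close>, this is the usual factorisation of
    \<open>r ^ n - 1\<close>.\<close>
  have "q * (\<Sum>k<n. r ^ k) + 1 = r ^ n" for n
    unfolding q by (induction n) (simp_all add: algebra_simps)
  then have "z ^ (q * ?S) * z = 1 * z" using fix_z by (metis mult_1 power_add power_one_right)
  then have "(z ^ q) ^ ?S = 1" using z0 by (simp add: power_mult)
  moreover have "(z ^ q) ^ (p ^ a) = 1" using z by (metis mult.commute power_mult power_one)
  ultimately have g: "(z ^ q) ^ gcd ?S (p ^ a) = 1" by (rule power_gcd_eq_one)
  obtain j where j: "gcd ?S (p ^ a) = p ^ j"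
    using divides_primepow_nat[OF p, of "gcd ?S (p ^ a)" a] by auto
  have "\<not> Suc i \<le> j"
  proof
    assume "Suc i \<le> j"
    then have "p ^ Suc i dvd gcd ?S (p ^ a)" unfolding j by (rule le_imp_power_dvd)
    then show False using prime_power_not_dvd_geometric_sum[OF p r r4, of i] by simp
  qed
  then have "p ^ j dvd p ^ i" by (intro le_imp_power_dvd) simp
  then have "(z ^ q) ^ (p ^ i) = 1" using g unfolding j by (auto simp: power_mult elim!: dvdE)
  then have "(z ^ (p ^ i)) ^ q = 1" by (metis mult.commute power_mult)
  then show ?thesis using q by simp
qed

section \<open>Characters of small codegree\<close>

lemma card_powers_primitive_root:
  fixes w :: complex
  assumes w: "\<And>k. w ^ k = 1 \<longleftrightarrow> Q dvd k" and Q: "Q > 0"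
  shows "card (range (\<lambda>j. w ^ j)) = Q"
proof -
  have w0: "w \<noteq> 0" using w[of Q] Q by (auto simp: power_0_left)
  have "range (\<lambda>j. w ^ j) \<subseteq> {z. z ^ Q = 1}"
    by (auto simp: w simp flip: power_mult)
  then have fin: "finite (range (\<lambda>j. w ^ j))" "card (range (\<lambda>j. w ^ j)) \<le> Q"
    using card_roots_unity_eq[OF Q] Q
    by (auto intro: finite_subset card_ge_0_finite dest: card_mono[rotated])
  have "inj_on (\<lambda>j. w ^ j) {..<Q}"
  proof (rule linorder_inj_onI)
    fix a b assume "a < b" "a \<in> {..<Q}" "b \<in> {..<Q}"
    then have "w ^ (b - a) \<noteq> 1" using w by (auto dest: dvd_imp_le)
    moreover have "w ^ b = w ^ a * w ^ (b - a)" using \<open>a < b\<close> by (simp flip: power_add)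
    ultimately show "w ^ a \<noteq> w ^ b" using w0 by auto
  qed auto
  then have "Q = card ((\<lambda>j. w ^ j) ` {..<Q})" by (simp add: card_image)
  also have "\<dots> \<le> card (range (\<lambda>j. w ^ j))" using fin by (intro card_mono) auto
  finally show ?thesis using fin by simp
qed

lemma card_multiples_lessThan:
  fixes d n :: nat
  assumes "d > 0"
  shows "card {j \<in> {..<d * n}. d dvd j} = n"
proof -
  have "{j \<in> {..<d * n}. d dvd j} = (\<lambda>k. d * k) ` {..<n}"
    using assms by (auto elim!: dvdE)
  then show ?thesis using assms by (simp add: card_image inj_on_def)
qed

lemma power_i_mod_4: "\<i> ^ n = \<i> ^ (n mod 4)"
proof -
  have "\<i> ^ n = \<i> ^ (4 * (n div 4) + n mod 4)" by simp
  also have "\<dots> = (\<i> ^ 4) ^ (n div 4) * \<i> ^ (n mod 4)" by (simp only: power_add power_mult)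
  finally show ?thesis by simp
qed

lemma power_4_eq_1_complex: "(w::complex) ^ 4 = 1 \<longleftrightarrow> w = 1 \<or> w = -1 \<or> w = \<i> \<or> w = -\<i>"
proof -
  have "w ^ 4 - 1 = (w - 1) * (w + 1) * (w - \<i>) * (w + \<i>)"
    by (simp add: algebra_simps eval_nat_numeral)
  then show ?thesis by (metis add_eq_0_iff2 diff_eq_diff_eq diff_self eq_iff_diff_eq_0 mult_eq_0_iff)
qed

context metacyclic_presentation
begin

text \<open>Each character of degree \<open>p ^ i\<close> comes from \<open>p ^ i\<close> admissible pairs \<open>(z, c)\<close> with
  \<open>orbit_size z = p ^ i\<close>, and for each \<open>i\<close> there are at most as many such pairs as linear
  characters; sum the resulting geometric series.\<close>

lemma card_Irr_less_twice_linear: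
  assumes p: "prime p" and M: "M = p ^ t"
    and fixed: "\<And>z::complex. z ^ K = 1 \<Longrightarrow> (z ^ orbit_size z) ^ r = z ^ orbit_size z"
  shows "card (Irr G) < 2 * card linear_chars"
proof -
  define Z where "Z i = {z::complex. z ^ K = 1 \<and> orbit_size z = p ^ i}" for i
  define X where "X i = {monomial_char z c | z c. z \<in> Z i \<and> admissible z c}" for i
  let ?F = "{z::complex. z ^ K = 1 \<and> z ^ r = z}"
  have finF: "finite ?F" by (rule finite_subset[OF _ finite_roots[OF K_pos, of 1]]) auto
  let ?L = "card linear_chars"
  have L: "?L = card ?F * M" by (rule card_linear_chars)
  have p0: "p > 0" using prime_gt_0_nat[OF p] .
  have "1 \<in> ?F" by simp
  then have "card ?F > 0" using finF by (metis card_gt_0_iff empty_iff)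
  then have Lpos: "?L > 0" using L M_pos by simp
  have cardX: "2 ^ i * card (X i) \<le> ?L" if i: "i \<le> t" for i
  proof -
    \<comment> \<open>Every point of \<open>Z i\<close> is a \<open>p ^ i\<close>-th root of a fixed
      point, which leaves \<open>p ^ i\<close> candidates over each one.\<close>
    have "Z i \<subseteq> (\<Union>a\<in>?F. {z. z ^ (p ^ i) = a})"
    proof
      fix z assume "z \<in> Z i"
      then have z: "z ^ K = 1" "orbit_size z = p ^ i" by (auto simp: Z_def)
      then have "(z ^ (p ^ i)) ^ K = 1" by (metis mult.commute power_mult power_one)
      then show "z \<in> (\<Union>a\<in>?F. {z. z ^ (p ^ i) = a})" using fixed[OF z(1)] z(2) by simp
    qed
    then have "card (Z i) \<le> card (\<Union>a\<in>?F. {z. z ^ (p ^ i) = a})"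
      using finF p0 finite_roots by (intro card_mono) auto
    also have "\<dots> \<le> (\<Sum>a\<in>?F. card {z. z ^ (p ^ i) = a})" by (rule card_UN_le[OF finF])
    also have "\<dots> = (\<Sum>a\<in>?F. p ^ i)"
    proof (intro sum.cong refl card_nth_roots)
      fix a assume "a \<in> ?F" then show "a \<noteq> 0" using z_nonzero by auto
    qed (use p0 in simp)
    finally have Zi: "card (Z i) \<le> card ?F * p ^ i" by simp
    have "p ^ i * card (X i) \<le> card (Z i) * (M div p ^ i)"
      unfolding X_def
    proof (rule card_monomial_chars_le)
      fix z k assume z: "z \<in> Z i"
      then obtain c where "admissible z c" using ex_admissible by (auto simp: Z_def)
      from admissible_orbit[OF this, of k] show "z ^ (r ^ k) \<in> Z i"
        using z by (auto simp: Z_def admissible_def)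
    qed (simp add: Z_def)
    also have "\<dots> \<le> card ?F * p ^ i * (M div p ^ i)" using Zi by (rule mult_le_mono1)
    also have "\<dots> = ?L"
    proof -
      have "p ^ i dvd M" unfolding M using i by (rule le_imp_power_dvd)
      then show ?thesis by (simp add: L mult.assoc)
    qed
    finally have "p ^ i * card (X i) \<le> ?L" .
    \<comment> \<open>Weakening \<open>p\<close> to 2 gives the ratio 1/2, for which the series
      stays below twice its first term.\<close>
    moreover have "2 ^ i * card (X i) \<le> p ^ i * card (X i)"
      using prime_ge_2_nat[OF p] by (intro mult_le_mono1 power_mono) auto
    ultimately show ?thesis by linarith
  qed
  have "Irr G \<subseteq> (\<Union>i\<le>t. X i)"
  proof
    fix \<chi> assume "\<chi> \<in> Irr G"
    then obtain z c where zc: "admissible z c" "\<chi> = monomial_char z c" by (auto simp: Irr_eq)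
    then have z: "z ^ K = 1" by (simp add: admissible_def)
    obtain i where "i \<le> t" "orbit_size z = p ^ i"
      using orbit_size_dvd_M[OF z] divides_primepow_nat[OF p] unfolding M by auto
    then show "\<chi> \<in> (\<Union>i\<le>t. X i)" using zc z by (auto simp: X_def Z_def)
  qed
  moreover have "X i \<subseteq> Irr G" for i by (auto simp: X_def Irr_eq)
  ultimately have "card (Irr G) \<le> card (\<Union>i\<le>t. X i)"
    using finite_Irr by (intro card_mono) (auto intro: finite_subset)
  also have "\<dots> \<le> (\<Sum>i\<le>t. card (X i))" by (rule card_UN_le) simp
  finally have "real (card (Irr G)) \<le> (\<Sum>i\<le>t. real (card (X i)))"
    by (metis of_nat_le_iff of_nat_sum)
  also have "\<dots> \<le> (\<Sum>i\<le>t. real ?L / 2 ^ i)"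
  proof (rule sum_mono)
    fix i assume "i \<in> {..t}"
    then have "real (2 ^ i * card (X i)) \<le> real ?L" using cardX by (simp only: of_nat_le_iff atMost_iff)
    then show "real (card (X i)) \<le> real ?L / 2 ^ i" by (simp add: field_simps)
  qed
  also have "\<dots> = real ?L * (2 - 1 / 2 ^ t)"
    by (induction t) (simp_all add: field_simps)
  also have "\<dots> < real ?L * 2" using Lpos by (intro mult_strict_left_mono) auto
  finally show ?thesis by linarith
qed

lemma orbit_size_one: "orbit_size 1 = 1"
  using Fix_iff[of 1] by simp

text \<open>Inflate a faithful character of the cyclic quotient: \<open>z = 1\<close> and
  \<open>c\<close> a primitive \<open>M\<close>-th root of unity.\<close>

lemma codegree_M: "\<exists>\<chi>\<in>Irr G. codegree G \<chi> = of_nat M"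
proof -
  obtain c :: complex where c: "\<And>k. c ^ k = 1 \<longleftrightarrow> M dvd k"
    using exists_primitive_root[OF M_pos] by blast
  have adm: "admissible 1 c" by (simp add: admissible_def orbit_size_one c)
  have "{c ^ j * 1 ^ i | (j::nat) (i::nat). True} = range (\<lambda>j. c ^ j)" by auto
  then have "ker_index 1 c = M"
    using ker_index_linear[OF adm orbit_size_one] card_powers_primitive_root[OF c M_pos] by simp
  then show ?thesis
    using monomial_char_in_Irr[OF adm] codegree_monomial_char[OF adm] by (auto simp: orbit_size_one)
qed

text \<open>For \<open>z\<close> of exact order \<open>q\<close> the index of the kernel is
  divisible by \<open>q\<close>. Later this restricts the prime divisors of
  \<open>K\<close>.\<close>

lemma codegree_divisible:
  assumes "q dvd K"
  obtains \<chi> a m where "\<chi> \<in> Irr G" "codegree G \<chi> = of_nat a / of_nat m" "m > 0" "m dvd M" "q dvd a"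
proof -
  have "q > 0" using assms K_pos by (auto intro: gr0I)
  then obtain z :: complex where z: "\<And>k. z ^ k = 1 \<longleftrightarrow> q dvd k"
    using exists_primitive_root by blast
  have zK: "z ^ K = 1" using z assms by simp
  obtain c where adm: "admissible z c" using ex_admissible[OF zK] by blast
  show thesis
    using that[OF monomial_char_in_Irr[OF adm] codegree_monomial_char[OF adm]
        orbit_size_pos[OF zK] orbit_size_dvd_M[OF zK]] z_pow_ker_index[OF adm] z by simp
qed

text \<open>Take \<open>z\<close> from \<open>1, -1\<close> and \<open>c\<close> from
  \<open>\<i>, -\<i>\<close>: in each of the four cases the image consists of all fourth roots of
  unity.\<close>

lemma codegree_4_linear:
  assumes "4 dvd M" "2 dvd K" "odd r" "even s"
  shows "4 \<le> card {\<chi> \<in> linear_chars. codegree G \<chi> = 4}"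
proof -
  let ?S = "{1, -1} \<times> {\<i>, -\<i>} :: (complex \<times> complex) set"
  let ?f = "\<lambda>(z, c). monomial_char z c"
  have zc: "orbit_size z = 1" "admissible z c" "codegree G (monomial_char z c) = 4"
    if "(z, c) \<in> ?S" for z c
  proof -
    have z2: "z ^ 2 = 1" and c4: "c ^ 4 = 1" and cases: "z = 1 \<or> z = -1" "c = \<i> \<or> c = -\<i>"
      using that by (auto simp: power_4_eq_1_complex)
    have zK: "z ^ K = 1" using assms(2) z2 by (auto simp: power_mult elim!: dvdE)
    have zs: "z ^ s = 1" using assms(4) z2 by (auto simp: power_mult elim!: evenE)
    have "z ^ r = z" using assms(3) z2 by (auto simp: power_mult elim!: oddE)
    then show o: "orbit_size z = 1" using Fix_iff[OF zK] by simp
    have "c ^ M = 1" using assms(1) c4 by (auto simp: power_mult elim!: dvdE)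
    then show adm: "admissible z c" using zK zs o by (simp add: admissible_def)
    have "{c ^ j * z ^ i | j i. True} = {1, -1, \<i>, -\<i>}" (is "?A = ?B")
    proof
      have "w ^ 4 = 1" if w: "w \<in> ?A" for w
      proof -
        obtain j i where "w = c ^ j * z ^ i" using w by blast
        then have "w ^ 4 = (c ^ 4) ^ j * ((z ^ 2) ^ 2) ^ i"
          by (simp add: power_mult_distrib mult.commute flip: power_mult)
        then show ?thesis using c4 z2 by simp
      qed
      then show "?A \<subseteq> ?B" using power_4_eq_1_complex by blast
      have "c ^ j \<in> ?A" for j
      proof -
        have "c ^ j = c ^ j * z ^ 0" by simp
        then show ?thesis by blast
      qed
      note this[of 0] this[of 1] this[of 2] this[of 3]
      moreover have "c ^ 2 = -1" "c ^ 3 = - c"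
        using cases(2) by (auto simp: power2_eq_square power3_eq_cube)
      ultimately have "{1, c, -1, -c} \<subseteq> ?A" by simp
      moreover have "?B = {1, c, -1, -c}" using cases(2) by auto
      ultimately show "?B \<subseteq> ?A" by (simp only:)
    qed
    moreover have "card {1, -1, \<i>, -\<i>} = 4" by (auto simp: complex_eq_iff)
    ultimately have "ker_index z c = 4" using ker_index_linear[OF adm o] by simp
    then show "codegree G (monomial_char z c) = 4" by (simp add: codegree_monomial_char[OF adm] o)
  qed
  have "inj_on ?f ?S"
    by (rule inj_on_subset[OF linear_char_inj]) (use zc in blast)
  then have "card (?f ` ?S) = card ?S" by (rule card_image)
  also have "card ?S = 4" by (simp add: card_cartesian_product complex_eq_iff)
  finally have "4 = card (?f ` ?S)" by simp
  also have "\<dots> \<le> card {\<chi> \<in> linear_chars. codegree G \<chi> = 4}"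
  proof (rule card_mono)
    show "finite {\<chi> \<in> linear_chars. codegree G \<chi> = 4}"
      by (rule finite_subset[OF _ finite_Irr]) (use linear_chars_subset in blast)
    show "?f ` ?S \<subseteq> {\<chi> \<in> linear_chars. codegree G \<chi> = 4}"
    proof
      fix \<chi> assume "\<chi> \<in> ?f ` ?S"
      then obtain q where q: "q \<in> ?S" "\<chi> = ?f q" by blast
      obtain z c where "q = (z, c)" by (cases q)
      then have "(z, c) \<in> ?S" "\<chi> = monomial_char z c" using q by auto
      then show "\<chi> \<in> {\<chi> \<in> linear_chars. codegree G \<chi> = 4}"
        using zc[of z c] monomial_char_linear_iff[of z c] by simp
    qed
  qed
  finally show ?thesis .
qed

text \<open>The inflation of the faithful character of the dihedral group of order 8.\<close>

lemma codegree_4_nonlinear: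
  assumes "even M" "4 dvd K" "r mod 4 = 3" "4 dvd s"
  obtains \<chi> where "\<chi> \<in> Irr G" "\<chi> \<notin> linear_chars" "codegree G \<chi> = 4"
proof -
  have iK: "\<i> ^ K = 1" using assms(2) power_i_mod_4[of K] by simp
  have ir: "\<i> ^ r = - \<i>" using power_i_mod_4[of r] assms(3) by (simp add: power3_eq_cube)
  \<comment> \<open>The orbit of \<open>\<i>\<close> consists of \<open>\<i>\<close> and
    \<open>-\<i>\<close>.\<close>
  have "(r ^ 2) mod 4 = 1" using assms(3) power_mod[of r 4 2] by simp
  then have "\<i> ^ (r ^ 2) = \<i>" using power_i_mod_4[of "r ^ 2"] by simp
  then have "orbit_size \<i> dvd 2" using orbit_size_dvd_iff[OF iK] by blast
  moreover have "orbit_size \<i> \<noteq> 1" using Fix_iff[OF iK] ir by (simp add: complex_eq_iff)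
  ultimately have o: "orbit_size \<i> = 2" using prime_nat_iff two_is_prime_nat by blast
  have "\<i> ^ s = 1" using power_i_mod_4[of s] assms(4) by simp
  then have adm: "admissible \<i> 1" using iK by (simp add: admissible_def)
  have four: "\<i> ^ i + \<i> ^ (i * r) = 2 \<longleftrightarrow> 4 dvd i" for i
  proof -
    have "\<i> ^ (i * r) = (- \<i>) ^ i" by (simp add: ir mult.commute[of i] power_mult)
    then have e: "\<i> ^ i + \<i> ^ (i * r) = (if even i then 2 * \<i> ^ i else 0)" by simp
    have "i mod 4 = 0 \<or> odd i \<or> i mod 4 = 2" by presburger
    then show ?thesis
    proof (elim disjE)
      assume 1: "i mod 4 = 0"
      then have "even i" "4 dvd i" by presburger+
      moreover have "\<i> ^ i = 1" using power_i_mod_4[of i] 1 by simp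
      ultimately show ?thesis unfolding e by simp
    next
      assume 2: "odd i"
      then have "\<not> 4 dvd i" by presburger
      then show ?thesis unfolding e using 2 by simp
    next
      assume 3: "i mod 4 = 2"
      then have "even i" "\<not> 4 dvd i" by presburger+
      moreover have "\<i> ^ i = -1" using power_i_mod_4[of i] 3 by simp
      ultimately show ?thesis unfolding e by simp
    qed
  qed
  \<comment> \<open>The character equals its degree 2 exactly on these words, so the kernel has
    index 8.\<close>
  have ker: "word j i \<in> character_kernel G (monomial_char \<i> 1) \<longleftrightarrow> even j \<and> 4 dvd i" for j i
    using four[of i] by (simp add: character_kernel_def monomial_char_word[OF adm]
        monomial_char_one[OF adm] o numeral_2_eq_2 del: One_nat_def)
  obtain a where a: "M = 2 * a" using assms(1) by blast
  obtain b where b: "K = 4 * b" using assms(2) by blast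
  let ?f = "\<lambda>(j, i). word j i"
  have "character_kernel G (monomial_char \<i> 1) = ?f ` ({j \<in> {..<M}. 2 dvd j} \<times> {i \<in> {..<K}. 4 dvd i})"
  proof
    show "character_kernel G (monomial_char \<i> 1) \<subseteq> ?f ` ({j \<in> {..<M}. 2 dvd j} \<times> {i \<in> {..<K}. 4 dvd i})"
    proof
      fix g assume g: "g \<in> character_kernel G (monomial_char \<i> 1)"
      then have "g \<in> ?f ` ({..<M} \<times> {..<K})"
        using word_bij by (simp add: bij_betw_def character_kernel_def)
      then show "g \<in> ?f ` ({j \<in> {..<M}. 2 dvd j} \<times> {i \<in> {..<K}. 4 dvd i})"
        using g ker by auto
    qed
  qed (use ker in auto)
  moreover have "inj_on ?f ({j \<in> {..<M}. 2 dvd j} \<times> {i \<in> {..<K}. 4 dvd i})"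
    by (rule inj_on_subset[OF bij_betw_imp_inj_on[OF word_bij]]) auto
  ultimately have "card (character_kernel G (monomial_char \<i> 1)) = a * b"
    using card_multiples_lessThan[of 2 a] card_multiples_lessThan[of 4 b]
    by (simp only: card_image card_cartesian_product a b)
  then have "ker_index \<i> 1 * (a * b) = 8 * (a * b)"
    using ker_index_mult_card[OF adm] a b by (simp add: mult_ac)
  moreover have "a * b > 0" using a b M_pos K_pos by simp
  ultimately have "ker_index \<i> 1 = 8" by (simp only: mult_cancel2) simp
  then show thesis
    using that[OF monomial_char_in_Irr[OF adm]] monomial_char_linear_iff[OF adm] o
    by (simp add: codegree_monomial_char[OF adm])
qed

text \<open>Degrees are 1 or 2. A linear character has \<open>z ^ 2 = c ^ 2 = 1\<close>, hence
  codegree at most 2. In degree 2 the index of the kernel is 8, so \<open>z\<close> is one of the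
  six eighth roots of unity other than \<open>1, -1\<close>; each has one admissible
  \<open>c\<close>, and every character uses two of them.\<close>

lemma card_codegree_4_le_3:
  assumes M: "M = 2" and fixed: "\<And>z::complex. z ^ K = 1 \<Longrightarrow> z ^ r = z \<Longrightarrow> z ^ 2 = 1"
    and r: "odd r" and s: "even s"
  shows "card {\<chi> \<in> Irr G. codegree G \<chi> = 4} \<le> 3"
proof -
  define Z where "Z = {z::complex. z ^ K = 1 \<and> orbit_size z = 2 \<and> z ^ 8 = 1}"
  have "{\<chi> \<in> Irr G. codegree G \<chi> = 4} \<subseteq> {monomial_char z c | z c. z \<in> Z \<and> admissible z c}"
  proof clarify
    fix \<chi> assume "\<chi> \<in> Irr G" and cod: "codegree G \<chi> = 4"
    then obtain z c where adm: "admissible z c" and \<chi>: "\<chi> = monomial_char z c" by (auto simp: Irr_eq)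
    have zK: "z ^ K = 1" using adm by (simp add: admissible_def)
    have "(of_nat (ker_index z c) :: complex) = of_nat (4 * orbit_size z)"
      using cod codegree_monomial_char[OF adm] orbit_size_pos[OF zK]
      unfolding \<chi> by (simp add: field_simps)
    then have k: "ker_index z c = 4 * orbit_size z" by (simp only: of_nat_eq_iff)
    have "orbit_size z \<noteq> 1"
    proof
      assume o: "orbit_size z = 1"
      have z2: "z ^ 2 = 1" using fixed[OF zK] Fix_iff[OF zK] o by simp
      have "z ^ s = 1" using s z2 by (auto simp: power_mult elim!: evenE)
      moreover have "c ^ (M div orbit_size z) = z ^ s" using adm by (simp add: admissible_def)
      ultimately have c2: "c ^ 2 = 1" using o M by simp
      have "ker_index z c \<le> 2" by (rule ker_index_linear_le[OF adm o z2 c2]) simp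
      then show False using k o by simp
    qed
    then have o: "orbit_size z = 2"
      using orbit_size_dvd_M[OF zK] M prime_nat_iff two_is_prime_nat by metis
    then have "z ^ 8 = 1" using z_pow_ker_index[OF adm] k by simp
    then show "\<exists>z c. \<chi> = monomial_char z c \<and> z \<in> Z \<and> admissible z c"
      using \<chi> adm o zK by (auto simp: Z_def)
  qed
  moreover have "{monomial_char z c | z c. z \<in> Z \<and> admissible z c} \<subseteq> Irr G" by (auto simp: Irr_eq)
  ultimately have "card {\<chi> \<in> Irr G. codegree G \<chi> = 4} \<le>
      card {monomial_char z c | z c. z \<in> Z \<and> admissible z c}"
    using finite_Irr by (intro card_mono) (auto intro: finite_subset)
  moreover have "2 * card {monomial_char z c | z c. z \<in> Z \<and> admissible z c} \<le> card Z * (M div 2)"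
  proof (rule card_monomial_chars_le)
    fix z k assume z: "z \<in> Z"
    then obtain c where "admissible z c" using ex_admissible by (auto simp: Z_def)
    from admissible_orbit[OF this, of k] show "z ^ (r ^ k) \<in> Z"
      using z by (auto simp: Z_def admissible_def) (metis mult.commute power_mult power_one)
  qed (auto simp: Z_def)
  moreover have "card Z \<le> 6"
  proof -
    have "(-1) ^ r = (-1 :: complex)" using r by simp
    then have "orbit_size (-1) = 1" if "(-1 :: complex) ^ K = 1" using Fix_iff[OF that] by simp
    then have "Z \<subseteq> {z. z ^ 8 = 1} - {1, -1}"
      by (auto simp: Z_def orbit_size_one)
    then have "card Z \<le> card ({z::complex. z ^ 8 = 1} - {1, -1})"
      by (intro card_mono finite_Diff finite_roots) auto
    also have "\<dots> = card {z::complex. z ^ 8 = 1} - card {1::complex, -1}"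
      by (rule card_Diff_subset) auto
    also have "\<dots> = 6" by (simp add: card_roots_unity_eq)
    finally show ?thesis .
  qed
  ultimately show ?thesis using M by simp
qed

text \<open>Codegree 4 forces \<open>c\<close> to have order exactly 4, leaving two choices for each
  of \<open>z\<close> and \<open>c\<close>. This is applied to \<open>A\<close> when
  \<open>p = 2\<close>.\<close>

lemma card_codegree_4_le_4:
  assumes K: "K = 2" and r: "r = 1"
  shows "card {\<chi> \<in> Irr G. codegree G \<chi> = 4} \<le> 4"
proof -
  let ?S = "{1, -1} \<times> {\<i>, -\<i>} :: (complex \<times> complex) set"
  have "{\<chi> \<in> Irr G. codegree G \<chi> = 4} \<subseteq> (\<lambda>(z, c). monomial_char z c) ` ?S"
  proof clarify
    fix \<chi> assume "\<chi> \<in> Irr G" and cod: "codegree G \<chi> = 4"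
    then obtain z c where adm: "admissible z c" and \<chi>: "\<chi> = monomial_char z c" by (auto simp: Irr_eq)
    have zK: "z ^ K = 1" using adm by (simp add: admissible_def)
    then have z2: "z ^ 2 = 1" by (simp add: K)
    have o: "orbit_size z = 1" using Fix_iff[OF zK] r by simp
    have "(of_nat (ker_index z c) :: complex) = of_nat 4"
      using cod codegree_monomial_char[OF adm] unfolding \<chi> by (simp add: o)
    then have k: "ker_index z c = 4" by (simp only: of_nat_eq_iff)
    have c4: "c ^ 4 = 1" using c_pow_ker_index[OF adm o] k by simp
    have "c ^ 2 \<noteq> 1"
    proof
      assume c2: "c ^ 2 = 1"
      have "ker_index z c \<le> 2" by (rule ker_index_linear_le[OF adm o z2 c2]) simp
      then show False using k by simp
    qed
    then have "c = \<i> \<or> c = -\<i>" using c4 by (auto simp: power_4_eq_1_complex)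
    moreover have "z = 1 \<or> z = -1" using z2 power2_eq_1_iff by blast
    ultimately show "\<chi> \<in> (\<lambda>(z, c). monomial_char z c) ` ?S" unfolding \<chi> by blast
  qed
  then have "card {\<chi> \<in> Irr G. codegree G \<chi> = 4} \<le> card ((\<lambda>(z, c). monomial_char z c) ` ?S)"
    by (intro card_mono) auto
  also have "\<dots> \<le> card ?S" by (rule card_image_le) simp
  also have "\<dots> = 4" by (simp add: card_cartesian_product complex_eq_iff)
  finally show ?thesis .
qed

end

section \<open>Presentations and structure of the groups\<close>

lemma (in group) subgroup_nat_pow_closed:
  assumes "subgroup H G" "x \<in> H"
  shows "x [^] (k::nat) \<in> H"
  using assms by (induction k) (auto simp: subgroup.one_closed subgroup.m_closed)

lemma (in group) int_pow_eq_nat_pow: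
  assumes fin: "finite (carrier G)" and x: "x \<in> carrier G"
  shows "\<exists>k::nat. x [^] (i::int) = x [^] k"
proof -
  have "ord x > 0" using ord_ge_1[OF fin x] by simp
  then have "i = int (ord x) * (i div int (ord x)) + int (nat (i mod int (ord x)))" by simp
  then have "x [^] i = (x [^] int (ord x)) [^] (i div int (ord x)) \<otimes> x [^] int (nat (i mod int (ord x)))"
    by (metis int_pow_mult int_pow_pow x)
  also have "\<dots> = x [^] nat (i mod int (ord x))"
    using x by (simp only: int_pow_int pow_ord_eq_1 int_pow_one l_one nat_pow_closed)
  finally show ?thesis by blast
qed

lemma (in group) cyclic_group_nat_pow:
  assumes fin: "finite (carrier G)" and cyc: "cyclic_group G"
  obtains x where "x \<in> carrier G" "\<And>g. g \<in> carrier G \<Longrightarrow> \<exists>k::nat. g = x [^] k"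
proof -
  obtain x where x: "x \<in> carrier G" "carrier G = range (\<lambda>n::int. x [^] n)"
    using cyc cyclic_group by blast
  have "\<exists>k::nat. g = x [^] k" if g: "g \<in> carrier G" for g
  proof -
    have "g \<in> range (\<lambda>n::int. x [^] n)" using g x(2) by simp
    then obtain i :: int where "g = x [^] i" by (rule rangeE)
    then show ?thesis using int_pow_eq_nat_pow[OF fin x(1), of i] by simp
  qed
  then show thesis using that x(1) by blast
qed

text \<open>\<open>x\<close> generates the normal subgroup \<open>N\<close> and \<open>y\<close>
  lifts a generator of the quotient; rewriting the coset \<open>N y\<close> as \<open>y N\<close>
  yields \<open>r\<close> and the normal forms.\<close>

lemma metacyclic_obtains_presentation:
  fixes G (structure)
  assumes "group G" and fin: "finite (carrier G)" and "metacyclic G"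
  obtains x y r s K M where "metacyclic_presentation G x y r s K M"
proof -
  interpret group G by fact
  obtain N where N: "N \<lhd> G" "cyclic_group (G\<lparr>carrier := N\<rparr>)" "cyclic_group (G Mod N)"
    using assms(3) unfolding metacyclic_def by blast
  interpret N: normal N G by (rule N)
  interpret Q: group "G Mod N" by (rule N.factorgroup_is_group)
  interpret NG: group "G\<lparr>carrier := N\<rparr>" by (rule subgroup_imp_group) (rule N.subgroup_axioms)
  interpret h: group_hom G "G Mod N" "\<lambda>a. N #> a"
    by unfold_locales (rule N.r_coset_hom_Mod)
  have Ncar: "N \<subseteq> carrier G" by (rule N.subset)
  have finN: "finite N" using fin Ncar by (rule rev_finite_subset)
  have carQ: "carrier (G Mod N) = (\<lambda>a. N #> a) ` carrier G"
    by (auto simp: FactGroup_def RCOSETS_def)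
  have finQ: "finite (carrier (G Mod N))" using fin by (simp add: carQ)
  obtain x where x: "x \<in> N" and xN: "\<And>g. g \<in> N \<Longrightarrow> \<exists>k::nat. g = x [^] k"
    using NG.cyclic_group_nat_pow[OF _ N(2)] finN by (auto simp flip: nat_pow_consistent)
  obtain Y where Y: "Y \<in> carrier (G Mod N)"
    and YQ: "\<And>g. g \<in> carrier (G Mod N) \<Longrightarrow> \<exists>k::nat. g = Y [^]\<^bsub>G Mod N\<^esub> k"
    using Q.cyclic_group_nat_pow[OF finQ N(3)] by blast
  obtain y where y: "y \<in> carrier G" "Y = N #> y" using Y carQ by blast
  have xG: "x \<in> carrier G" using x Ncar by blast
  have one: "\<one>\<^bsub>G Mod N\<^esub> = N" by (simp add: FactGroup_def)
  have Ypow: "Y [^]\<^bsub>G Mod N\<^esub> (k::nat) = N #> y [^] k" for k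
    using h.hom_nat_pow[OF y(1), of k] y(2) by simp
  have inN: "N #> a = N \<longleftrightarrow> a \<in> N" if "a \<in> carrier G" for a
    using that coset_join1 coset_join2 N.subgroup_axioms by blast
  have swap: "\<exists>k::nat. g = a \<otimes> x [^] k" if "g \<in> N #> a" "a \<in> carrier G" for g a
  proof -
    have "g \<in> a <# N" using that N.coset_eq by blast
    then obtain u where "u \<in> N" "g = a \<otimes> u" by (auto simp: l_coset_def)
    then show ?thesis using xN by blast
  qed
  have "x \<otimes> y \<in> N #> y" using x by (auto simp: r_coset_def)
  then obtain r :: nat where r: "x \<otimes> y = y \<otimes> x [^] r" using swap y(1) by blast
  let ?M = "Q.ord Y"
  have "N #> y [^] ?M = N"
    using Ypow[of ?M] Q.pow_ord_eq_1[OF Y] one by metis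
  then have "y [^] ?M \<in> N" using inN y(1) by blast
  then obtain s :: nat where s: "y [^] ?M = x [^] s" using xN by blast
  have "metacyclic_presentation G x y r s (ord x) ?M"
  proof
    show "ord x > 0" using ord_ge_1[OF fin xG] by simp
    show "?M > 0" using Q.ord_ge_1[OF finQ Y] by simp
    show "(x [^] (i::nat) = \<one>) = (ord x dvd i)" for i using pow_eq_id[OF xG] .
    show "?M dvd j" if "y [^] j = x [^] i" for j i :: nat
    proof -
      have "x [^] i \<in> N" using x by (rule subgroup_nat_pow_closed[OF N.subgroup_axioms])
      then have "Y [^]\<^bsub>G Mod N\<^esub> j = \<one>\<^bsub>G Mod N\<^esub>" using that Ypow one inN xG by simp
      then show ?thesis using Q.pow_eq_id[OF Y] by simp
    qed
    show "\<exists>(j::nat) i::nat. g = y [^] j \<otimes> x [^] i" if g: "g \<in> carrier G" for g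
    proof -
      obtain j :: nat where "N #> g = N #> y [^] j" using YQ[of "N #> g"] g carQ Ypow by auto
      then have "g \<in> N #> y [^] j" using rcos_self[OF g N.subgroup_axioms] by simp
      then show ?thesis using swap y(1) by blast
    qed
  qed (use xG y(1) r s in simp_all)
  then show thesis using that by blast
qed

lemma nat_pow_DirProd:
  "(a, b) [^]\<^bsub>A \<times>\<times> B\<^esub> (k::nat) = (a [^]\<^bsub>A\<^esub> k, b [^]\<^bsub>B\<^esub> k)"
  by (induction k) simp_all

text \<open>\<open>x\<close> generates the factor of order \<open>p\<close> and \<open>y\<close> the
  one of order \<open>q\<close>; \<open>r = 1\<close> because they commute, \<open>s = 0\<close>
  because \<open>y ^ q\<close> is trivial.\<close>

lemma presentation_DirProd_integer_mod_group:
  assumes "p > 1" "q > 1"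
  shows "metacyclic_presentation (integer_mod_group q \<times>\<times> integer_mod_group p) (0, 1) (1, 0) 1 0 p q"
proof -
  interpret group "integer_mod_group q \<times>\<times> integer_mod_group p"
    by (intro DirProd_group group_integer_mod_group)
  show ?thesis
  proof
    fix g assume "g \<in> carrier (integer_mod_group q \<times>\<times> integer_mod_group p)"
    then obtain a b where "g = (a, b)" "0 \<le> a" "a < int q" "0 \<le> b" "b < int p"
      using assms by (auto simp: carrier_integer_mod_group)
    then show "\<exists>(j::nat) i::nat. g = (1, 0) [^]\<^bsub>integer_mod_group q \<times>\<times> integer_mod_group p\<^esub> j
        \<otimes>\<^bsub>integer_mod_group q \<times>\<times> integer_mod_group p\<^esub>
        (0, 1) [^]\<^bsub>integer_mod_group q \<times>\<times> integer_mod_group p\<^esub> i"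
      by (intro exI[of _ "nat a"] exI[of _ "nat b"]) (simp add: nat_pow_DirProd)
  next
    fix i :: nat
    show "((0, 1) [^]\<^bsub>integer_mod_group q \<times>\<times> integer_mod_group p\<^esub> i =
        \<one>\<^bsub>integer_mod_group q \<times>\<times> integer_mod_group p\<^esub>) = (p dvd i)"
      by (simp add: nat_pow_DirProd flip: zmod_int dvd_eq_mod_eq_0)
  next
    fix j i :: nat
    assume "(1, 0) [^]\<^bsub>integer_mod_group q \<times>\<times> integer_mod_group p\<^esub> j =
        (0, 1) [^]\<^bsub>integer_mod_group q \<times>\<times> integer_mod_group p\<^esub> i"
    then show "q dvd j"
      by (simp add: nat_pow_DirProd flip: zmod_int dvd_eq_mod_eq_0)
  qed (use assms in \<open>simp_all add: nat_pow_DirProd\<close>)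
qed

text \<open>Choosing \<open>x\<close> trivial makes the whole cyclic group the quotient, so that
  \<open>codegree_M\<close> yields a character whose codegree is the group order.\<close>

lemma (in group) presentation_of_generator:
  assumes g: "g \<in> carrier G" and fin: "finite (carrier G)" and ord: "ord g = Coset.order G"
  shows "metacyclic_presentation G \<one> g 1 0 1 (Coset.order G)"
proof
  have gen: "generate G {g} = carrier G"
  proof (rule card_subset_eq[OF fin])
    show "generate G {g} \<subseteq> carrier G" using g generate_incl by blast
    show "card (generate G {g}) = card (carrier G)"
      using generate_pow_card[OF g] ord by (simp add: Coset.order_def)
  qed
  show "\<exists>(j::nat) i::nat. h = g [^] j \<otimes> \<one> [^] i" if h: "h \<in> carrier G" for h
  proof -
    obtain k :: int where "h = g [^] k" using h gen generate_pow[OF g] by auto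
    then obtain j :: nat where "h = g [^] j" using int_pow_eq_nat_pow[OF fin g, of k] by blast
    then have "h = g [^] j \<otimes> \<one> [^] (0::nat)" using g by simp
    then show ?thesis by blast
  qed
  show "Coset.order G > 0" using fin g by (auto simp: Coset.order_def card_gt_0_iff)
  show "Coset.order G dvd j" if "g [^] j = \<one> [^] i" for j i :: nat
    using that pow_eq_id[OF g, of j] by (simp add: ord)
  show "g [^] Coset.order G = \<one> [^] (0::nat)" using pow_order_eq_1[OF g] by simp
qed (use g in simp_all)

text \<open>In a non-cyclic abelian group of order \<open>p ^ Suc n\<close>, the \<open>p\<close>-th power of an element outside
  \<open>\<langle>g\<rangle>\<close> is a \<open>p\<close>-th power in \<open>\<langle>g\<rangle>\<close>, so \<open>\<langle>g\<rangle>\<close> has a complement of order \<open>p\<close>.\<close>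

lemma (in comm_group) iso_DirProd_of_order_prime_power:
  assumes p: "prime p" and n: "n > 0" and ord_G: "Coset.order G = p ^ Suc n"
    and g: "g \<in> carrier G" "ord g = p ^ n"
    and noncyclic: "\<And>u. u \<in> carrier G \<Longrightarrow> ord u \<noteq> p ^ Suc n"
  shows "G \<cong> integer_mod_group (p ^ n) \<times>\<times> integer_mod_group p"
proof -
  let ?A = "integer_mod_group (p ^ n) \<times>\<times> integer_mod_group p"
  interpret A: group ?A by (intro DirProd_group group_integer_mod_group)
  have p1: "p > 1" and p0: "p > 0" using prime_gt_1_nat[OF p] by auto
  have fin: "finite (carrier G)"
    using ord_G p0 order_gt_0_iff_finite by simp
  let ?H = "generate G {g}"
  have H: "subgroup ?H G" using g(1) by (intro generate_is_subgroup) simp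
  have cardH: "card ?H = p ^ n" using generate_pow_card[OF g(1)] g(2) by simp
  have powH: "g [^] (k::nat) \<in> ?H" for k
  proof -
    have "g [^] int k \<in> ?H" unfolding generate_pow[OF g(1)] by blast
    then show ?thesis by (simp add: int_pow_int)
  qed
  have H_pow: "\<exists>k::nat. a = g [^] k" if a: "a \<in> ?H" for a
  proof -
    obtain i :: int where "a = g [^] i" using a generate_pow[OF g(1)] by auto
    then show ?thesis using int_pow_eq_nat_pow[OF fin g(1), of i] by simp
  qed
  have "card ?H < card (carrier G)"
    using cardH ord_G p1 by (simp add: Coset.order_def)
  then have "?H \<noteq> carrier G" by auto
  then obtain u where u: "u \<in> carrier G" "u \<notin> ?H"
    using subgroup.subset[OF H] by blast
  have "card (rcosets ?H) * card ?H = p ^ Suc n" using lagrange[OF H] ord_G by simp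
  then have "card (rcosets ?H) = p" using cardH p0 by simp
  then have "u [^] p \<in> ?H"
    using normal.pow_card_rcosets_in[OF subgroup_imp_normal[OF H] fin u(1)] by simp
  then obtain k :: nat where k: "u [^] p = g [^] k" using H_pow by blast
  \<comment> \<open>This is where noncyclicity enters: the order of \<open>u\<close> is a power of
    \<open>p\<close> below \<open>p ^ Suc n\<close>.\<close>
  have "u [^] (p ^ n) = \<one>"
  proof -
    obtain i where i: "i \<le> Suc n" "ord u = p ^ i"
      using ord_dvd_group_order[OF u(1)] divides_primepow_nat[OF p] unfolding ord_G by blast
    then have "i \<le> n" using noncyclic[OF u(1)] by (cases "i = Suc n") auto
    then show ?thesis using i pow_eq_id[OF u(1)] by (simp add: le_imp_power_dvd)
  qed
  moreover have pn: "p * p ^ (n - 1) = p ^ n" using n by (cases n) simp_all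
  moreover have "g [^] (k * p ^ (n - 1)) = (u [^] p) [^] (p ^ (n - 1))"
    using g(1) by (simp add: k nat_pow_pow)
  ultimately have "g [^] (k * p ^ (n - 1)) = \<one>" using u(1) by (simp add: nat_pow_pow)
  then have "p ^ n dvd k * p ^ (n - 1)" using pow_eq_id[OF g(1)] g(2) by simp
  then have "p * p ^ (n - 1) dvd k * p ^ (n - 1)" by (simp only: pn)
  then have "p dvd k" using p0 by simp
  then obtain l where l: "k = p * l" by (elim dvdE)
  \<comment> \<open>Dividing \<open>u\<close> by a \<open>p\<close>-th root of \<open>u ^ p\<close>
    taken in the group generated by \<open>g\<close> gives an element with trivial
    \<open>p\<close>-th power that still lies outside this group.\<close>
  define h where "h = u \<otimes> inv (g [^] l)"
  have h: "h \<in> carrier G" using u g by (simp add: h_def)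
  have "h [^] p = u [^] p \<otimes> inv ((g [^] l) [^] p)"
    using u g by (simp add: h_def pow_mult_distrib m_comm nat_pow_inv)
  also have "\<dots> = \<one>" using k l g(1) by (simp add: nat_pow_pow mult.commute)
  finally have hp: "h [^] p = \<one>" .
  have h_notin: "h \<notin> ?H"
  proof
    assume "h \<in> ?H"
    then have "h \<otimes> g [^] l \<in> ?H" using subgroup.m_closed[OF H] powH by blast
    then show False using u g by (simp add: h_def m_assoc)
  qed
  have red: "v [^] (k mod m) = v [^] k" if "v \<in> carrier G" "v [^] m = \<one>" for v and k m :: nat
  proof -
    have "v [^] k = v [^] (m * (k div m) + k mod m)" by simp
    also have "\<dots> = (v [^] m) [^] (k div m) \<otimes> v [^] (k mod m)"
      using that(1) by (simp only: nat_pow_mult nat_pow_pow nat_pow_closed)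
    finally show ?thesis using that by simp
  qed
  have gpn: "g [^] (p ^ n) = \<one>" using pow_ord_eq_1[OF g(1)] g(2) by simp
  define \<phi> where "\<phi> = (\<lambda>(a, b). g [^] nat a \<otimes> h [^] nat b)"
  have carA: "carrier ?A = {0..<int (p ^ n)} \<times> {0..<int p}"
    using p0 by (auto simp: carrier_integer_mod_group)
  have hom: "\<phi> \<in> hom ?A G"
  proof (rule homI)
    fix v assume "v \<in> carrier ?A" then show "\<phi> v \<in> carrier G" using g h by (auto simp: \<phi>_def)
  next
    fix v w assume "v \<in> carrier ?A" "w \<in> carrier ?A"
    then obtain a b a' b' where vw: "v = (a, b)" "w = (a', b')" "0 \<le> a" "0 \<le> a'" "0 \<le> b" "0 \<le> b'"
      unfolding carA by auto
    have 1: "nat ((a + a') mod int (p ^ n)) = (nat a + nat a') mod (p ^ n)"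
      using vw by (simp add: nat_mod_distrib nat_add_distrib del: of_nat_power)
    have 2: "nat ((b + b') mod int p) = (nat b + nat b') mod p"
      using vw by (simp add: nat_mod_distrib nat_add_distrib)
    have "\<phi> (v \<otimes>\<^bsub>?A\<^esub> w) = g [^] (nat a + nat a') \<otimes> h [^] (nat b + nat b')"
      using red[OF g(1) gpn] red[OF h hp] 1 2 by (simp add: \<phi>_def vw del: of_nat_power)
    also have "\<dots> = \<phi> v \<otimes> \<phi> w"
      using g h by (simp add: \<phi>_def vw m_ac flip: nat_pow_mult)
    finally show "\<phi> (v \<otimes>\<^bsub>?A\<^esub> w) = \<phi> v \<otimes> \<phi> w" .
  qed
  interpret \<phi>: group_hom ?A G \<phi> by unfold_locales (rule hom)
  have inj: "inj_on \<phi> (carrier ?A)"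
    unfolding \<phi>.inj_on_one_iff
  proof (intro allI impI)
    fix v assume v: "v \<in> carrier ?A" "\<phi> v = \<one>"
    then obtain a b where ab: "v = (a, b)" "0 \<le> a" "a < int (p ^ n)" "0 \<le> b" "b < int p"
      unfolding carA by auto
    have e: "g [^] nat a \<otimes> h [^] nat b = \<one>" using v ab by (simp add: \<phi>_def)
    then have "h [^] nat b = inv (g [^] nat a)"
      using g h by (metis inv_equality inv_inv nat_pow_closed m_comm)
    then have hb: "h [^] nat b \<in> ?H" using subgroup.m_inv_closed[OF H powH] by simp
    have "b = 0"
    proof (rule ccontr)
      assume "b \<noteq> 0"
      then have "0 < nat b" "nat b < p" using ab by auto
      \<comment> \<open>Inverting \<open>b\<close> modulo \<open>p\<close> would make
        \<open>h\<close> a power of \<open>h ^ b\<close>, hence a power of \<open>g\<close>.\<close>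
      then have "coprime (nat b) p"
        using p by (metis coprime_commute nat_dvd_not_less prime_imp_coprime)
      then obtain c where "[nat b * c = Suc 0] (mod p)" using cong_solve_coprime_nat by blast
      then have "(nat b * c) mod p = 1" using p1 by (simp add: cong_def)
      then have "h = (h [^] nat b) [^] c"
        using red[OF h hp, of "nat b * c"] h by (simp add: nat_pow_pow)
      then show False using hb h_notin subgroup_nat_pow_closed[OF H] by metis
    qed
    then have "g [^] nat a = \<one>" using e g by simp
    then have "p ^ n dvd nat a" using pow_eq_id[OF g(1)] g(2) by simp
    moreover have "nat a < p ^ n" using ab by linarith
    ultimately have "nat a = 0" using nat_dvd_not_less by blast
    then show "v = \<one>\<^bsub>?A\<^esub>" using ab \<open>b = 0\<close> by simp
  qed
  have "card (carrier ?A) = p ^ Suc n"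
    unfolding carA by (simp add: card_cartesian_product del: of_nat_power)
  then have "card (\<phi> ` carrier ?A) = card (carrier G)"
    using card_image[OF inj] ord_G by (simp add: Coset.order_def)
  then have "\<phi> ` carrier ?A = carrier G"
    using \<phi>.hom_closed by (intro card_subset_eq[OF fin]) auto
  then have "\<phi> \<in> iso ?A G" using hom inj by (simp add: iso_def bij_betw_def)
  then have "?A \<cong> G" by (auto simp: is_iso_def)
  then show ?thesis by (rule A.iso_sym)
qed

section \<open>Comparison of the characters\<close>

text \<open>Iterated Fermat; it reduces \<open>r ^ M\<close> to \<open>r\<close> modulo
  \<open>p\<close> when \<open>M\<close> is a power of \<open>p\<close>.\<close>

lemma fermat_little_power:
  fixes p a :: nat
  assumes p: "prime p"
  shows "[a ^ (p ^ t) = a] (mod p)"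
proof (induction t)
  case (Suc t)
  have fermat: "[b ^ p = b] (mod p)" for b :: nat
  proof (cases "p dvd b")
    case True
    then have "p dvd b ^ p" using prime_gt_0_nat[OF p] by (metis dvd_power dvd_trans)
    then show ?thesis using True by (simp add: cong_def)
  next
    case False
    have "[b * b ^ (p - 1) = b * 1] (mod p)"
      by (intro cong_mult cong_refl fermat_theorem p False)
    moreover have "b * b ^ (p - 1) = b ^ p" using prime_gt_0_nat[OF p] by (cases p) simp_all
    ultimately show ?thesis by simp
  qed
  have "a ^ (p ^ Suc t) = (a ^ (p ^ t)) ^ p" by (simp add: mult.commute flip: power_mult)
  then show ?case using fermat[of "a ^ (p ^ t)"] Suc cong_trans by metis
qed simp

lemma prime_power_of_unique_prime_divisor:
  fixes K p :: nat
  assumes "K > 0" "prime p" and uniq: "\<And>q. prime q \<Longrightarrow> q dvd K \<Longrightarrow> q = p"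
  shows "\<exists>a. K = p ^ a"
proof -
  obtain u where u: "K = p ^ multiplicity p K * u" "\<not> p dvd u"
    using multiplicity_decompose'[of K p] assms prime_gt_1_nat[of p] by (metis neq0_conv not_prime_unit)
  have "u = 1"
  proof (rule ccontr)
    assume "u \<noteq> 1"
    then obtain q where "prime q" "q dvd u" using prime_factor_nat by blast
    then show False using uniq[of q] u by (metis dvd_mult)
  qed
  then show ?thesis using u(1) by auto
qed

context metacyclic_presentation
begin

section \<open>Linear characters, exponents and commutativity\<close>

lemma codegree_linear_char:
  assumes "\<chi> \<in> linear_chars"
  obtains a where "codegree G \<chi> = of_nat a" "a dvd M * K"
proof -
  obtain z c where zc: "orbit_size z = 1" "admissible z c" "\<chi> = monomial_char z c"
    using assms by (auto simp: linear_chars_def)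
  show thesis
    using that[of "ker_index z c"] codegree_monomial_char[OF zc(2)] ker_index_mult_card[OF zc(2)] zc
    by (metis dvd_triv_left div_by_1 of_nat_1)
qed

text \<open>If \<open>e\<close> kills both \<open>x\<close> and \<open>y\<close>, it kills
  \<open>z\<close> and \<open>c\<close>, so the image lies among the \<open>e\<close>-th roots of
  unity. In this way codegrees detect the exponent.\<close>

lemma codegree_linear_char_le:
  assumes exponent: "K dvd e" "e > 0" "y [^] e = \<one>" and \<chi>: "\<chi> \<in> linear_chars"
  obtains a where "codegree G \<chi> = of_nat a" "a \<le> e"
proof -
  obtain z c where zc: "orbit_size z = 1" "admissible z c" "\<chi> = monomial_char z c"
    using \<chi> by (auto simp: linear_chars_def)
  have "z ^ K = 1" using zc(2) by (simp add: admissible_def)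
  then have z: "z ^ e = 1" using exponent(1) by (auto simp: power_mult elim!: dvdE)
  have "word e 0 = word 0 0" using exponent(3) by (simp add: word_def)
  then have c: "c ^ e = 1"
    using monomial_char_word[OF zc(2), of e 0] monomial_char_word[OF zc(2), of 0 0] zc(1) by simp
  have "ker_index z c \<le> e" by (rule ker_index_linear_le[OF zc(2,1) z c exponent(2)])
  then show thesis using that[of "ker_index z c"] codegree_monomial_char[OF zc(2)] zc by simp
qed

text \<open>Now \<open>x ^ r = x\<close>, so \<open>x\<close> and \<open>y\<close> commute and all
  orbits are single points.\<close>

lemma abelian_if_r_cong_1:
  assumes "[r = 1] (mod K)"
  shows "comm_group G" "linear_chars = Irr G" "card (Irr G) = M * K"
proof -
  have xr: "x [^] r = x" using x_pow_eq_iff[of r 1] assms by simp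
  have z: "z ^ r = z" if "z ^ K = 1" for z :: complex
    using root_power_cong[OF that assms] by simp
  show "comm_group G"
  proof (rule group_comm_groupI)
    fix g h assume "g \<in> carrier G" "h \<in> carrier G"
    then obtain j i j' i' where gh: "g = word j i" "h = word j' i'" using ex_word by metis
    have rk: "[i * r ^ k = i] (mod K)" for i k
      using cong_mult[OF cong_refl[of i] cong_pow[OF assms, of k]] by simp
    have "[i * r ^ j' + i' = i' * r ^ j + i] (mod K)"
      using cong_add[OF rk[of i j'] cong_refl[of i']] cong_add[OF rk[of i' j] cong_refl[of i]]
      by (metis add.commute cong_sym cong_trans)
    then have "x [^] (i * r ^ j' + i') = x [^] (i' * r ^ j + i)" by (simp only: x_pow_eq_iff)
    then show "g \<otimes> h = h \<otimes> g"
      unfolding gh word_mult by (simp add: word_def add.commute)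
  qed
  show lin: "linear_chars = Irr G"
    using z Fix_iff by (auto simp: linear_chars_def Irr_eq admissible_def)
  have "{w::complex. w ^ K = 1 \<and> w ^ r = w} = {w. w ^ K = 1}" using z by auto
  then show "card (Irr G) = M * K"
    using card_linear_chars lin card_roots_unity_eq[OF K_pos] by simp
qed

text \<open>If \<open>r = 0\<close>, then \<open>r ^ M\<close> is 0 and \<open>K\<close> must be 1.
  This protects the natural subtraction \<open>r - 1\<close>.\<close>

lemma r_pos_or_cong_1: "r > 0 \<or> [r = 1] (mod K)"
proof (cases "r = 0")
  case True
  then show ?thesis using r_pow_M_cong M_pos by (simp add: power_0_left)
qed simp

text \<open>As \<open>z\<close> is nonzero, being fixed means \<open>z ^ (r - 1) = 1\<close>; Bezout
  merges this with \<open>z ^ K = 1\<close>.\<close>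

lemma card_fixed_roots:
  assumes "r > 0"
  shows "card {z::complex. z ^ K = 1 \<and> z ^ r = z} = gcd K (r - 1)"
proof -
  have r: "z ^ r = z * z ^ (r - 1)" for z :: complex
    using assms by (cases r) simp_all
  have fix_iff: "z ^ r = z \<longleftrightarrow> z ^ (r - 1) = 1" if "z ^ K = 1" for z :: complex
    using z_nonzero[OF that] by (simp add: r)
  have pow: "z ^ n = 1" if "z ^ gcd K (r - 1) = 1" "gcd K (r - 1) dvd n" for z :: complex and n
    using that by (metis dvdE power_mult power_one)
  have "{z::complex. z ^ K = 1 \<and> z ^ r = z} = {z. z ^ gcd K (r - 1) = 1}"
  proof (rule Collect_cong)
    fix z :: complex
    show "z ^ K = 1 \<and> z ^ r = z \<longleftrightarrow> z ^ gcd K (r - 1) = 1"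
      using fix_iff[of z] pow[of z K] pow[of z "r - 1"] power_gcd_eq_one[of z K "r - 1"] by auto
  qed
  then show ?thesis using card_roots_unity_eq[of "gcd K (r - 1)"] K_pos by simp
qed

text \<open>The linear characters number a power of \<open>p\<close>, and so do all the irreducible ones; as the
  ratio is less than two, there are no others.\<close>

lemma r_cong_1_if_card_Irr:
  assumes p: "prime p" and M: "M = p ^ t" and K: "K = p ^ a" and card: "card (Irr G) = p ^ N"
    and fixed: "\<And>z::complex. z ^ K = 1 \<Longrightarrow> (z ^ orbit_size z) ^ r = z ^ orbit_size z"
  shows "[r = 1] (mod K)"
proof (rule ccontr)
  assume nc: "\<not> [r = 1] (mod K)"
  then have r: "r > 0" using r_pos_or_cong_1 by blast
  have "gcd K (r - 1) dvd p ^ a" by (simp add: K)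
  then obtain f where "gcd K (r - 1) = p ^ f" using divides_primepow_nat[OF p] by blast
  then have "card linear_chars = p ^ f * M"
    by (simp add: card_linear_chars card_fixed_roots[OF r])
  then have L: "card linear_chars = p ^ (f + t)" using M by (metis power_add)
  have "card linear_chars \<le> card (Irr G)" by (rule card_mono[OF finite_Irr linear_chars_subset])
  then have "f + t \<le> N" using card L prime_gt_1_nat[OF p] by simp
  have "p ^ N < 2 * p ^ (f + t)"
    using card_Irr_less_twice_linear[OF p M fixed] card L by simp
  also have "\<dots> \<le> p ^ Suc (f + t)" using prime_ge_2_nat[OF p] by simp
  finally have "N < Suc (f + t)" using prime_gt_1_nat[OF p] by (simp only: power_strict_increasing_iff)
  then have "f + t = N" using \<open>f + t \<le> N\<close> by simp
  then have "card linear_chars = card (Irr G)" by (simp only: card L)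
  then have "linear_chars = Irr G" by (rule card_subset_eq[OF finite_Irr linear_chars_subset])
  then show False using nonlinear_char_exists[OF nc] by blast
qed

text \<open>Lifting the exponent covers odd \<open>p\<close> and \<open>r\<close> congruent to 1
  modulo 4. In the remaining case \<open>K\<close> divides 4: an orbit of even length gives a power
  equal to 1 or -1, which the odd exponent \<open>r\<close> fixes.\<close>

lemma fixed_power_orbit_size:
  assumes p: "prime p" and M: "M = p ^ t" and K: "K = p ^ a"
    and cases: "p = 2 \<Longrightarrow> r mod 4 = 1 \<or> K dvd 4" and z: "(z::complex) ^ K = 1"
  shows "(z ^ orbit_size z) ^ r = z ^ orbit_size z"
proof (cases "a = 0")
  case True
  then show ?thesis using z K by simp
next
  case False
  then have "p dvd K" using K by simp
  then have "[r ^ M = 1] (mod p)" using r_pow_M_cong by (rule cong_dvd_modulus_nat[rotated])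
  then have r: "[r = 1] (mod p)" using fermat_little_power[OF p, of r t] M by (metis cong_sym cong_trans)
  obtain i where i: "orbit_size z = p ^ i"
    using orbit_size_dvd_M[OF z] divides_primepow_nat[OF p] unfolding M by blast
  show ?thesis
  proof (cases "p = 2 \<and> r mod 4 \<noteq> 1")
    case False
    then have "p = 2 \<Longrightarrow> [r = 1] (mod 4)" by (simp add: cong_def)
    from power_orbit_size_fixed[OF p r this, of z a i] show ?thesis
      using z orbit_size_fix[OF z] unfolding K i by simp
  next
    case True
    then have "K dvd 4" using cases by blast
    then have z4: "z ^ 4 = 1" using z by (metis dvdE power_mult power_one)
    have "odd r" using r True by (metis cong_dvd_iff dvd_1_iff_1 even_numeral even_Suc_Suc_iff odd_one)
    show ?thesis
    proof (cases i)
      case 0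
      then show ?thesis using Fix_iff[OF z] i by simp
    next
      case (Suc i')
      have "(z ^ orbit_size z) ^ 2 = (z ^ 4) ^ (2 ^ i')"
        using True by (simp add: i Suc mult.commute flip: power_mult)
      then have "(z ^ orbit_size z) ^ 2 = 1" using z4 by simp
      then have "z ^ orbit_size z = 1 \<or> z ^ orbit_size z = -1" by (rule power2_eq_1_iff[THEN iffD1])
      then show ?thesis using \<open>odd r\<close> by auto
    qed
  qed
qed

end

theorem theorem2p3:
  fixes G :: "('a, 'b) monoid_scheme" and A :: "(int \<times> int) monoid" and p n :: nat
  assumes "prime p" and "n > 0"
    and A: "A = integer_mod_group (p ^ n) \<times>\<times> integer_mod_group p"
    and "group G" and "finite (carrier G)" and "metacyclic G"
    and "group_pseudo_algebra G = group_pseudo_algebra A"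
  shows "comm_group G \<and> G \<cong> A"
proof -
  note p = \<open>prime p\<close> and n = \<open>n > 0\<close>
  have p1: "p > 1" using prime_gt_1_nat[OF p] .
  have pn1: "p ^ n > 1" by (rule one_less_power[OF p1 n])
  interpret A: metacyclic_presentation A "(0, 1)" "(1, 0)" 1 0 p "p ^ n"
    unfolding A by (rule presentation_DirProd_integer_mod_group[OF p1 pn1])
  note A_linear = A.abelian_if_r_cong_1[OF cong_refl]
  have card_Irr_A: "card (Irr A) = p ^ Suc n" using A_linear(3) by (simp add: mult.commute)

  \<comment> \<open>Codegrees and the number of characters of \<open>G\<close>\<close>
  have Cod: "Cod G = Cod A"
  proof -
    have "Cod H = fst ` group_pseudo_algebra H" for H :: "('c, 'd) monoid_scheme"
      by (force simp: group_pseudo_algebra_def)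
    then show ?thesis using assms(7) by metis
  qed
  \<comment> \<open>Outside the common set of codegrees both multiplicities are zero, so the
    equality holds for every \<open>d\<close>.\<close>
  have mult: "codegree_mult G d = codegree_mult A d" for d
  proof (cases "d \<in> Cod G")
    case True
    then have "(d, codegree_mult G d) \<in> group_pseudo_algebra A"
      unfolding assms(7)[symmetric] by (auto simp: group_pseudo_algebra_def)
    then show ?thesis by (auto simp: group_pseudo_algebra_def)
  next
    case False
    then have "{\<chi> \<in> Irr G. codegree G \<chi> = d} = {}" "{\<chi> \<in> Irr A. codegree A \<chi> = d} = {}"
      using Cod by (auto simp: Cod_def)
    then show ?thesis by (simp only: codegree_mult_def card.empty)
  qed
  obtain x y r s K M where "metacyclic_presentation G x y r s K M"
    using metacyclic_obtains_presentation assms by blast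
  then interpret metacyclic_presentation G x y r s K M .
  have card_sum: "card I = (\<Sum>d\<in>f ` I. card {\<chi> \<in> I. f \<chi> = d})"
    if "finite I" for I :: "'c set" and f :: "'c \<Rightarrow> complex"
    using sum.image_gen[OF that, of "\<lambda>_. 1::nat" f] by simp
  have "card (Irr G) = (\<Sum>d\<in>Cod G. codegree_mult G d)"
    using card_sum[OF finite_Irr, of "codegree G"] by (simp add: codegree_mult_def Cod_def Setcompr_eq_image)
  also have "\<dots> = card (Irr A)"
    unfolding Cod mult
    using card_sum[OF A.finite_Irr, of "codegree A"] by (simp add: codegree_mult_def Cod_def Setcompr_eq_image)
  finally have card_Irr: "card (Irr G) = p ^ Suc n" using card_Irr_A by simp

  have Cod_A_power: "\<exists>k. d = of_nat (p ^ k)" if d: "d \<in> Cod A" for d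
  proof -
    obtain \<chi> where \<chi>: "\<chi> \<in> Irr A" "d = codegree A \<chi>" using d by (auto simp: Cod_def)
    then have "\<chi> \<in> A.linear_chars" using A_linear(2) by simp
    then obtain a where "codegree A \<chi> = of_nat a" "a dvd p ^ n * p"
      by (rule A.codegree_linear_char)
    moreover have "p ^ n * p = p ^ Suc n" by simp
    ultimately show ?thesis using divides_primepow_nat[OF p] \<chi>(2) by metis
  qed
  have Cod_G_power: "\<exists>k. codegree G \<chi> = of_nat (p ^ k)" if "\<chi> \<in> Irr G" for \<chi>
    using that Cod Cod_A_power by (auto simp: Cod_def)

  \<comment> \<open>\<open>M\<close> and \<open>K\<close> are powers of \<open>p\<close>\<close>
  obtain t where M: "M = p ^ t"
    using codegree_M Cod_G_power by (metis of_nat_eq_iff)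
  obtain a where K: "K = p ^ a"
  proof -
    have "q = p" if q: "prime q" "q dvd K" for q
    proof -
      obtain \<chi> b m where \<chi>: "\<chi> \<in> Irr G" "codegree G \<chi> = of_nat b / of_nat m" "m > 0"
        "m dvd M" "q dvd b" using codegree_divisible[OF q(2)] .
      obtain k where "codegree G \<chi> = of_nat (p ^ k)" using Cod_G_power[OF \<chi>(1)] by blast
      \<comment> \<open>The codegree \<open>b / m\<close> is a power of \<open>p\<close> and
        \<open>m\<close> divides a power of \<open>p\<close>, so \<open>b\<close> is one as
        well.\<close>
      then have "(of_nat b :: complex) = of_nat (p ^ k * m)" using \<chi>(2,3) by (simp add: field_simps)
      then have "b = p ^ k * m" by (simp only: of_nat_eq_iff)
      then have "q dvd p ^ k * p ^ t" using \<chi>(4,5) unfolding M by (metis dvd_refl dvd_trans mult_dvd_mono)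
      then have "q dvd p" using q(1) by (auto simp: prime_dvd_mult_iff dest: prime_dvd_power)
      then show "q = p" using q(1) p primes_dvd_imp_eq by blast
    qed
    then show thesis using that prime_power_of_unique_prime_divisor[OF K_pos p] by blast
  qed

  \<comment> \<open>Commutativity of \<open>G\<close>\<close>
  have r: "[r = 1] (mod K)"
  proof (cases "p = 2 \<and> r mod 4 \<noteq> 1 \<and> \<not> K dvd 4")
    case False
    then show ?thesis
      using r_cong_1_if_card_Irr[OF p M K card_Irr fixed_power_orbit_size[OF p M K]] by blast
  next
    case True
    then have p2: "p = 2" and r4: "r mod 4 \<noteq> 1" and K4: "\<not> K dvd 4" by auto
    have "\<not> a \<le> 2"
    proof
      assume "a \<le> 2"
      then have "K dvd 2 ^ 2" unfolding K p2 by (rule le_imp_power_dvd)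
      then show False using K4 by simp
    qed
    then have "2 ^ 3 dvd K" unfolding K p2 by (intro le_imp_power_dvd) simp
    then have K8: "8 dvd K" by simp
    then have K24: "4 dvd K" "2 dvd K" by (auto elim: dvd_trans[rotated])
    have "[r ^ M = 1] (mod 2)" using K24(2) r_pow_M_cong by (rule cong_dvd_modulus_nat[rotated])
    then have "[r = 1] (mod 2)"
      using fermat_little_power[OF two_is_prime_nat, of r t] M p2 by (metis cong_sym cong_trans)
    then have odd: "odd r" by (simp add: cong_def odd_iff_mod_2_eq_one)
    then have r3: "r mod 4 = 3" using r4 by presburger
    \<comment> \<open>Since \<open>r - 1\<close> is twice an odd number,
      \<open>8 dvd s * (r - 1)\<close> gives \<open>4 dvd s\<close>.\<close>
    have "[s * r = s] (mod 8)" using s_mult_r_cong K8 by (rule cong_dvd_modulus_nat)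
    then have s4: "4 dvd s"
    proof -
      obtain u where u: "r = 4 * u + 3" using r3 by (metis mult_div_mod_eq)
      have "s * r - s = 2 * (s * (2 * u + 1))" by (simp add: u algebra_simps)
      moreover have "8 dvd s * r - s"
        using \<open>[s * r = s] (mod 8)\<close> cong_altdef_nat[of s "s * r" 8] u by simp
      ultimately have "2 * 4 dvd 2 * (s * (2 * u + 1))" by simp
      then have "2 ^ 2 dvd s * (2 * u + 1)" by (simp only: nat_mult_dvd_cancel_disj) simp
      moreover have "coprime (2 ^ 2) (2 * u + 1)"
        by (simp only: coprime_power_left_iff coprime_left_2_iff_odd) simp
      ultimately have "2 ^ 2 dvd s" by (simp only: coprime_dvd_mult_left_iff)
      then show ?thesis by simp
    qed
    \<comment> \<open>The order of \<open>z\<close> divides both a power of 2 and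
      \<open>r - 1\<close>, which is 2 modulo 4.\<close>
    have fixed2: "z ^ 2 = 1" if z: "z ^ K = 1" "z ^ r = z" for z :: complex
    proof -
      obtain u where u: "r = 4 * u + 3" using r3 by (metis mult_div_mod_eq)
      have "z * z ^ (4 * u + 2) = z * 1" using z(2) by (simp add: u eval_nat_numeral)
      then have "z ^ (4 * u + 2) = 1" using z_nonzero[OF z(1)] by simp
      then have "z ^ gcd K (4 * u + 2) = 1" by (rule power_gcd_eq_one[OF z(1)])
      moreover have "gcd K (4 * u + 2) dvd 2"
      proof -
        obtain k where k: "gcd K (4 * u + 2) = 2 ^ k"
          using divides_primepow_nat[OF two_is_prime_nat, of "gcd K (4 * u + 2)" a] K p2 by auto
        have "\<not> 2 \<le> k"
        proof
          assume "2 \<le> k"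
          then have "2 ^ 2 dvd gcd K (4 * u + 2)" unfolding k by (rule le_imp_power_dvd)
          then have "4 dvd 4 * u + 2" by simp
          then show False by presburger
        qed
        then have "2 ^ k dvd (2 ^ 1 :: nat)" by (intro le_imp_power_dvd) simp
        then show ?thesis using k by simp
      qed
      ultimately show ?thesis by (metis dvdE power_mult power_one)
    qed
    have "t \<noteq> 0"
    proof
      assume "t = 0"
      then have "[r = 1] (mod K)" using r_pow_M_cong M by simp
      then have "[r = 1] (mod 4)" using K24(1) by (rule cong_dvd_modulus_nat)
      then show False using r4 by (simp add: cong_def)
    qed
    then have evenM: "even M" by (simp add: M p2)
    obtain \<chi> where \<chi>: "\<chi> \<in> Irr G" "\<chi> \<notin> linear_chars" "codegree G \<chi> = 4"
      using codegree_4_nonlinear[OF evenM K24(1) r3 s4] .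
    have evens: "even s" using s4 by (rule dvd_trans[rotated]) simp
    have False
    proof (cases "t = 1")
      case False
      \<comment> \<open>Four linear characters of codegree 4 together with \<chi> make at least
        five, but \<open>A\<close> has at most four.\<close>
      then have "2 ^ 2 dvd M" unfolding M p2 using \<open>t \<noteq> 0\<close> by (intro le_imp_power_dvd) simp
      then have "4 \<le> card {\<chi> \<in> linear_chars. codegree G \<chi> = 4}"
        using codegree_4_linear K24(2) odd evens by simp
      also have "\<dots> < card {\<chi> \<in> Irr G. codegree G \<chi> = 4}"
        using \<chi> linear_chars_subset finite_Irr by (intro psubset_card_mono) auto
      also have "\<dots> \<le> 4"
        using mult[of 4] A.card_codegree_4_le_4[OF p2 refl] by (simp add: codegree_mult_def)
      finally show False by simp
    next
      case True
      then have M2: "M = 2" by (simp add: M p2)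
      show False
      proof (cases "n = 1")
        case True
        \<comment> \<open>At least two fixed roots and \<open>M = 2\<close> give four linear
          characters, as many as \<open>G\<close> has irreducible characters, leaving no room for
          \<chi>.\<close>
        have "{1, -1} \<subseteq> {z::complex. z ^ K = 1 \<and> z ^ r = z}"
          using K24(2) odd by auto
        moreover have "finite {z::complex. z ^ K = 1 \<and> z ^ r = z}"
          by (rule finite_subset[OF _ finite_roots[OF K_pos, of 1]]) blast
        ultimately have "card {1::complex, -1} \<le> card {z::complex. z ^ K = 1 \<and> z ^ r = z}"
          by (rule card_mono[rotated])
        then have "card (Irr G) \<le> card linear_chars"
          using card_linear_chars card_Irr M2 True p2 by simp
        then have "linear_chars = Irr G"
          by (rule card_seteq[OF finite_Irr linear_chars_subset])
        then show False using \<chi> by simp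
      next
        case False
        \<comment> \<open>Here \<open>A\<close> has at least four characters of codegree 4, but
          \<open>G\<close> at most three.\<close>
        then have "2 ^ 2 dvd p ^ n" unfolding p2 using n by (intro le_imp_power_dvd) simp
        then have "4 \<le> card {\<chi> \<in> A.linear_chars. codegree A \<chi> = 4}"
          using p2 by (intro A.codegree_4_linear) auto
        also have "\<dots> = card {\<chi> \<in> Irr G. codegree G \<chi> = 4}"
          using mult[of 4] A_linear(2) by (simp add: codegree_mult_def)
        also have "\<dots> \<le> 3" using card_codegree_4_le_3[OF M2 fixed2 odd evens] .
        finally show False by simp
      qed
    qed
    then show ?thesis ..
  qed

  \<comment> \<open>Isomorphism type of the abelian group \<open>G\<close>\<close>
  note G_linear = abelian_if_r_cong_1[OF r]
  interpret comm_group G by (rule G_linear(1))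
  have ord_G: "Coset.order G = p ^ Suc n" using order_eq G_linear(3) card_Irr by simp

  \<comment> \<open>A generator would produce the codegree \<open>p ^ Suc n\<close>, whereas the
    exponent of \<open>A\<close> bounds its codegrees by \<open>p ^ n\<close>.\<close>
  have noncyclic: "ord u \<noteq> p ^ Suc n" if u: "u \<in> carrier G" for u
  proof
    assume "ord u = p ^ Suc n"
    then interpret C: metacyclic_presentation G "\<one>\<^bsub>G\<^esub>" u 1 0 1 "Coset.order G"
      using ord_G by (intro presentation_of_generator[OF u finite_carrier]) simp
    obtain \<chi> where \<chi>: "\<chi> \<in> Irr G" "codegree G \<chi> = of_nat (p ^ Suc n)"
      using C.codegree_M ord_G by auto
    have "of_nat (p ^ Suc n) \<in> Cod G"
      unfolding Cod_def by (intro CollectI exI[of _ \<chi>]) (simp only: \<chi> simp_thms)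
    then obtain \<psi> where \<psi>: "\<psi> \<in> A.linear_chars" "codegree A \<psi> = of_nat (p ^ Suc n)"
      using A_linear(2) unfolding Cod by (auto simp: Cod_def simp del: of_nat_power)
    have "p dvd p ^ n" using n by (intro dvd_power) simp
    moreover have "p ^ n > 0" using pn1 by linarith
    moreover have "(1, 0) [^]\<^bsub>A\<^esub> (p ^ n) = \<one>\<^bsub>A\<^esub>" using A.y_pow_M by simp
    ultimately obtain b where b: "codegree A \<psi> = of_nat b" "b \<le> p ^ n"
      using \<psi>(1) by (rule A.codegree_linear_char_le)
    have "(of_nat b :: complex) = of_nat (p ^ Suc n)" by (rule trans[OF b(1)[symmetric] \<psi>(2)])
    then have "b = p ^ Suc n" by (simp only: of_nat_eq_iff)
    then show False using b(2) p1 by simp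
  qed
  \<comment> \<open>Conversely, \<open>A\<close> has the codegree \<open>p ^ n\<close>, which an
    exponent dividing \<open>p ^ (n - 1)\<close> would rule out in \<open>G\<close>.\<close>
  have "\<exists>g\<in>carrier G. g [^]\<^bsub>G\<^esub> (p ^ (n - 1)) \<noteq> \<one>\<^bsub>G\<^esub>"
  proof (rule ccontr)
    assume "\<not> ?thesis"
    then have triv: "g [^]\<^bsub>G\<^esub> (p ^ (n - 1)) = \<one>\<^bsub>G\<^esub>" if "g \<in> carrier G" for g using that by blast
    have "of_nat (p ^ n) \<in> Cod A" using A.codegree_M by (force simp: Cod_def)
    then obtain \<psi> where \<psi>: "\<psi> \<in> linear_chars" "codegree G \<psi> = of_nat (p ^ n)"
      using G_linear(2) unfolding Cod[symmetric] by (auto simp: Cod_def simp del: of_nat_power)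
    have "K dvd p ^ (n - 1)" "p ^ (n - 1) > 0" "y [^]\<^bsub>G\<^esub> (p ^ (n - 1)) = \<one>\<^bsub>G\<^esub>"
      using triv[OF x_closed] triv[OF y_closed] x_pow_eq_one p1 by simp_all
    then obtain b where b: "codegree G \<psi> = of_nat b" "b \<le> p ^ (n - 1)"
      using \<psi>(1) by (rule codegree_linear_char_le)
    have "(of_nat b :: complex) = of_nat (p ^ n)" by (rule trans[OF b(1)[symmetric] \<psi>(2)])
    then have "b = p ^ n" by (simp only: of_nat_eq_iff)
    then show False using b(2) p1 n by simp
  qed
  then obtain g where g: "g \<in> carrier G" "g [^]\<^bsub>G\<^esub> (p ^ (n - 1)) \<noteq> \<one>\<^bsub>G\<^esub>" by blast
  obtain i where i: "i \<le> Suc n" "ord g = p ^ i"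
    using ord_dvd_group_order[OF g(1)] divides_primepow_nat[OF p, of "ord g" "Suc n"]
    unfolding ord_G by auto
  have "\<not> i \<le> n - 1"
  proof
    assume "i \<le> n - 1"
    then have "ord g dvd p ^ (n - 1)" unfolding i(2) by (rule le_imp_power_dvd)
    then show False using pow_eq_id[OF g(1)] g(2) by blast
  qed
  moreover have "i \<noteq> Suc n" using noncyclic[OF g(1)] i(2) by blast
  ultimately have "i = n" using i(1) by linarith
  then have "G \<cong> A"
    unfolding A using iso_DirProd_of_order_prime_power[OF p n ord_G g(1)] i(2) noncyclic by blast
  then show ?thesis using G_linear(1) by blast
qed

end
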